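(* For every $m\in\mathbb N\setminus\{2,3,5\}$, in the Ulam–Rényi game over $\{0,\dots,2^m-1\}$ with at most $3$ lies there exists a perfect strategy all of whose questions are $4$-interval questions.
   Context: Game: Responder picks $x\in\mathcal U=\{0,\dots,2^m-1\}$; Questioner asks questions "$x\in Q$?" with $Q\subseteq\mathcal U$; Responder may lie at most 3 times. A state is a map $\sigma:\mathcal U\to\{0,1,2,3,4\}$ (number of answers falsified by each element, truncated at 4); the initial state is identically $0$; after question $Q$, $\sigma_{yes}(y)=\min\{\sigma(y)+[y\notin Q],4\}$, $\sigma_{no}(y)=\min\{\sigma(y)+[y\in Q],4\}$. A state is final if $|\{y:\sigma(y)<4\}|\le1$. A strategy of size $q$ is a complete binary tree of depth $q$ with internal nodes labelled by questions, edges by answers; it is winning if the state at every leaf is final. $N_{\min}(2^m,3)=\min\{q:2^{q-m}\ge\sum_{i=0}^3\binom qi\}$; a perfect strategy is a winning strategy for the initial state of size $N_{\min}(2^m,3)$. An interval is $\emptyset$ or $\{x\in\mathcal U:a\le x\le b\}$; a 4-interval question is a union of at most 4 intervals. *)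

theory Defs
  imports Main
begin

definition universe :: "nat \<Rightarrow> nat set" where
  "universe m = {..<2^m}"

text \<open>States: maps from elements to the number of falsified answers (truncated at 4).\<close>
type_synonym state = "nat \<Rightarrow> nat"

definition init_state :: state where
  "init_state = (\<lambda>_. 0)"

definition state_yes :: "state \<Rightarrow> nat set \<Rightarrow> state" where
  "state_yes \<sigma> Q = (\<lambda>y. min (\<sigma> y + (if y \<notin> Q then 1 else 0)) 4)"

definition state_no :: "state \<Rightarrow> nat set \<Rightarrow> state" where
  "state_no \<sigma> Q = (\<lambda>y. min (\<sigma> y + (if y \<in> Q then 1 else 0)) 4)"

definition final :: "nat \<Rightarrow> state \<Rightarrow> bool" where
  "final m \<sigma> \<longleftrightarrow> card {y \<in> universe m. \<sigma> y < 4} \<le> 1"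

text \<open>Strategy trees: internal nodes labelled by questions; left subtree = answer yes,
  right subtree = answer no.\<close>
datatype strategy = Leaf | Node "nat set" strategy strategy

fun winning :: "nat \<Rightarrow> nat \<Rightarrow> state \<Rightarrow> strategy \<Rightarrow> bool" where
  "winning m 0 \<sigma> Leaf = final m \<sigma>"
| "winning m (Suc q) \<sigma> (Node Q ty tn) =
     (Q \<subseteq> universe m \<and> winning m q (state_yes \<sigma> Q) ty \<and> winning m q (state_no \<sigma> Q) tn)"
| "winning m _ _ _ = False"

fun questions :: "strategy \<Rightarrow> nat set set" where
  "questions Leaf = {}"
| "questions (Node Q ty tn) = insert Q (questions ty \<union> questions tn)"

text \<open>N_min(2^m,3) = min{q. 2^(q-m) \<ge> sum_{i=0}^3 (q choose i)}, written with
  the (equivalent, integer) inequality 2^m * sum \<le> 2^q.\<close>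
definition N_min :: "nat \<Rightarrow> nat" where
  "N_min m = (LEAST q. 2^m * (\<Sum>i\<le>3. q choose i) \<le> (2::nat)^q)"

definition perfect_strategy :: "nat \<Rightarrow> strategy \<Rightarrow> bool" where
  "perfect_strategy m t \<longleftrightarrow> winning m (N_min m) init_state t"

definition is_interval :: "nat \<Rightarrow> nat set \<Rightarrow> bool" where
  "is_interval m I \<longleftrightarrow> I = {} \<or> (\<exists>a b. I = {x \<in> universe m. a \<le> x \<and> x \<le> b})"

definition four_interval_question :: "nat \<Rightarrow> nat set \<Rightarrow> bool" where
  "four_interval_question m Q \<longleftrightarrow>
     (\<exists>Is. length Is \<le> 4 \<and> (\<forall>I \<in> set Is. is_interval m I) \<and> Q = \<Union> (set Is))"

end

theory Submission
  imports Defs "HOL-Library.Code_Binary_Nat" "HOL-Library.Multiset"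
begin

text \<open>
  Only the numbers \<open>(a, b, c, d)\<close> of candidates with 0, 1, 2, 3 falsified answers matter for who wins
  if arbitrary questions are allowed. Halving every class \<open>m\<close> times leads from \<open>(2 ^ m, 0, 0, 0)\<close>
  to \<open>(1, m, m choose 2, m choose 3)\<close>. From there on the state is padded with dummies of the last class
  until its Berlekamp weight is exactly \<open>2 ^ n\<close>, \<open>n\<close> being the number of questions left; the dummies
  absorb every imbalance of a nearly halving question. For \<open>n \<ge> 21\<close> plain halving keeps the first
  three classes so small that it never gets stuck before \<open>n = 8\<close>; what remains is a finite table.

  To ask only 4-interval questions, arrange the surviving candidates on a circle, so that a state is a
  cyclic word over 0, 1, 2, 3. A set of candidates with at most 8 boundaries on the circle, or
  its complement, is a union of 4 intervals, and complementing a question only swaps the answers. Seven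
  cyclic patterns of at most 8 runs turn out to be closed under suitable questions with at most 8
  boundaries that select any prescribed number of candidates from each class.
\<close>

section \<open>The game on types\<close>

text \<open>Padding is free because \<open>wins\<close> survives the deletion of candidates, and it
  makes the last class a function of the other three, so only triples need a table. The two answers
  share the old weight between them; hence both successors can be made exact again as soon as
  neither is overweight before the last class is distributed.

  The weight bound alone does not settle small states: for \<open>m\<close> = 2, 3, 5 it is first
  met with 8, 8 and 9 questions left after the halvings, and the table has no entry for the states
  that arise there. The threshold 21 is the first number from which
  \<open>220 * n ^ 3 \<le> 2 ^ n\<close> holds for good.

  The geometric half takes the amounts to be selected as arbitrary, so the two halves never
  interact. Infinitely many amounts and run lengths reduce to finitely many comparisons, because the
  cut inside a run may be anywhere and one choice of picks therefore serves a whole range of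
  amounts. The complement is needed when the place where the circle is cut open into the line lies
  inside the selected part.\<close>

fun wins :: "nat \<Rightarrow> nat \<Rightarrow> nat \<Rightarrow> nat \<Rightarrow> nat \<Rightarrow> bool" where
  "wins 0 a b c d \<longleftrightarrow> a + b + c + d \<le> 1"
| "wins (Suc q) a b c d \<longleftrightarrow> (\<exists>a' b' c' d'. a' \<le> a \<and> b' \<le> b \<and> c' \<le> c \<and> d' \<le> d \<and>
     wins q a' (b' + (a - a')) (c' + (b - b')) (d' + (c - c')) \<and>
     wins q (a - a') (b - b' + a') (c - c' + b') (d - d' + c'))"

text \<open>The old question, cut down by \<open>min\<close> to the candidates that remain, has
  successors dominated by the old ones in every class.\<close>

lemma wins_mono:
  assumes "wins q a b c d" "a1 \<le> a" "b1 \<le> b" "c1 \<le> c" "d1 \<le> d"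
  shows "wins q a1 b1 c1 d1"
  using assms
proof (induction q arbitrary: a b c d a1 b1 c1 d1)
  case 0
  then show ?case by simp
next
  case (Suc q)
  from Suc.prems(1) obtain a' b' c' d' where le: "a' \<le> a" "b' \<le> b" "c' \<le> c" "d' \<le> d"
    and y: "wins q a' (b' + (a - a')) (c' + (b - b')) (d' + (c - c'))"
    and n: "wins q (a - a') (b - b' + a') (c - c' + b') (d - d' + c')"
    by auto
  have "wins q (min a' a1) (min b' b1 + (a1 - min a' a1)) (min c' c1 + (b1 - min b' b1))
      (min d' d1 + (c1 - min c' c1))"
    by (rule Suc.IH[OF y]) (use le Suc.prems in auto)
  moreover have "wins q (a1 - min a' a1) (b1 - min b' b1 + min a' a1) (c1 - min c' c1 + min b' b1)
      (d1 - min d' d1 + min c' c1)"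
    by (rule Suc.IH[OF n]) (use le Suc.prems in auto)
  ultimately show ?case
    unfolding wins.simps
    by (intro exI[of _ "min a' a1"] exI[of _ "min b' b1"] exI[of _ "min c' c1"] exI[of _ "min d' d1"]) simp
qed

lemma wins_le_1: "a + b + c + d \<le> 1 \<Longrightarrow> wins q a b c d"
proof (induction q arbitrary: a b c d)
  case (Suc q)
  have "wins q a b c d" "wins q 0 a b c" using Suc by simp_all
  then show ?case
    unfolding wins.simps by (intro exI[of _ a] exI[of _ b] exI[of _ c] exI[of _ d]) simp
qed simp

text \<open>The question takes half of every class, so both answers lead to the same state, and
  Pascal's rule turns \<open>k\<close> into \<open>Suc k\<close>. The case \<open>k = 0\<close> is
  the one about \<open>2 ^ j\<close> untouched candidates.\<close>

lemma wins_halving: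
  assumes "wins n 1 (j + k) ((j + k) choose 2) ((j + k) choose 3)"
  shows "wins (n + j) (2 ^ j) (2 ^ j * k) (2 ^ j * (k choose 2)) (2 ^ j * (k choose 3))"
  using assms
proof (induction j arbitrary: k)
  case (Suc j)
  have w: "wins (n + j) (2 ^ j) (2 ^ j * Suc k) (2 ^ j * (Suc k choose 2)) (2 ^ j * (Suc k choose 3))"
    by (rule Suc.IH) (use Suc.prems in simp)
  have ch: "Suc k choose 2 = (k choose 2) + k" "Suc k choose 3 = (k choose 3) + (k choose 2)"
    by (simp_all add: numeral_2_eq_2 numeral_3_eq_3)
  have "wins (Suc (n + j)) (2 ^ Suc j) (2 ^ Suc j * k) (2 ^ Suc j * (k choose 2)) (2 ^ Suc j * (k choose 3))"
    unfolding wins.simps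
    by (rule exI[of _ "2 ^ j"], rule exI[of _ "2 ^ j * k"], rule exI[of _ "2 ^ j * (k choose 2)"],
        rule exI[of _ "2 ^ j * (k choose 3)"])
       (use w in \<open>simp add: ch algebra_simps\<close>)
  then show ?case by simp
qed simp

text \<open>The size of a Hamming ball of radius \<open>k\<close> in words of length
  \<open>n\<close>; also the Berlekamp weight, with \<open>n\<close> questions left, of a candidate
  that survives \<open>k\<close> more falsified answers.\<close>

definition vol :: "nat \<Rightarrow> nat \<Rightarrow> nat" where
  "vol k n = (\<Sum>i\<le>k. n choose i)"

lemma vol_0 [simp]: "vol 0 n = 1" "vol k 0 = 1"
  by (simp_all add: vol_def sum.atMost_shift)

lemma vol_Suc: "vol (Suc k) (Suc n) = vol (Suc k) n + vol k n"
  unfolding vol_def by (subst sum.atMost_Suc_shift, subst sum.atMost_Suc_shift) (simp add: sum.distrib)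

lemma vol_1: "vol 1 n = n + 1" "vol (Suc 0) n = n + 1"
  by (simp_all add: vol_def)

lemma vol_rec: "vol 3 (Suc n) = vol 3 n + vol 2 n" "vol 2 (Suc n) = vol 2 n + vol 1 n"
    "vol 1 (Suc n) = vol 1 n + 1"
  using vol_Suc[of 2 n] vol_Suc[of 1 n] vol_Suc[of 0 n]
  by (simp_all add: numeral_3_eq_3 numeral_2_eq_2)

lemma vol_2: "2 * vol 2 n = n * n + n + 2"
  by (induction n) (simp_all add: vol_rec vol_1)

lemma vol_3: "6 * vol 3 n = n * n * n + 5 * n + 6"
proof (induction n)
  case (Suc n)
  then show ?case using vol_2[of n] by (simp add: vol_rec algebra_simps)
qed simp

text \<open>Vandermonde: the flipped positions are divided between the \<open>n\<close> and the
  \<open>m\<close> places. The right side is the weight of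
  \<open>(1, m, m choose 2, m choose 3)\<close> with \<open>n\<close> questions left, so
  \<open>vol 3 (n + m) \<le> 2 ^ n\<close> says that the state after \<open>m\<close> halvings is
  not overweight.\<close>

lemma vol_add: "vol 3 (n + m) = vol 3 n + m * vol 2 n + (m choose 2) * vol 1 n + (m choose 3)"
proof (induction m arbitrary: n)
  case (Suc m)
  have "vol 3 (n + Suc m) = vol 3 (Suc n + m)" by simp
  also have "\<dots> = vol 3 (Suc n) + m * vol 2 (Suc n) + (m choose 2) * vol 1 (Suc n) + (m choose 3)"
    by (rule Suc.IH)
  also have "\<dots> = vol 3 n + Suc m * vol 2 n + (Suc m choose 2) * vol 1 n + (Suc m choose 3)"
    unfolding vol_rec by (simp add: numeral_2_eq_2 numeral_3_eq_3 algebra_simps)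
  finally show ?case .
qed (simp add: numeral_2_eq_2 numeral_3_eq_3)

text \<open>The Berlekamp weight of the first three classes; a candidate of the last class has weight 1.\<close>

definition load :: "nat \<Rightarrow> nat \<Rightarrow> nat \<Rightarrow> nat \<Rightarrow> nat" where
  "load n a b c = a * vol 3 n + b * vol 2 n + c * vol 1 n"

text \<open>The inequality makes the subtraction of naturals exact, so the padded state really has
  weight \<open>2 ^ n\<close>.\<close>

definition tight_wins :: "nat \<Rightarrow> nat \<times> nat \<times> nat \<Rightarrow> bool" where
  "tight_wins n t = (case t of (a, b, c) \<Rightarrow> load n a b c \<le> 2 ^ n \<and> wins n a b c (2 ^ n - load n a b c))"

text \<open>Conservation of weight: the weights after the two answers add up to the weight before.
  \<open>c - c'\<close> and \<open>c'\<close> are the candidates that enter the last class on yes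
  and on no.\<close>

lemma tight_wins_Suc:
  assumes le: "a' \<le> a" "b' \<le> b" "c' \<le> c"
    and y: "load n a' (b' + (a - a')) (c' + (b - b')) + (c - c') \<le> 2 ^ n"
    and z: "load n (a - a') (b - b' + a') (c - c' + b') + c' \<le> 2 ^ n"
    and "tight_wins n (a', b' + (a - a'), c' + (b - b'))" "tight_wins n (a - a', b - b' + a', c - c' + b')"
  shows "tight_wins (Suc n) (a, b, c)"
proof -
  obtain x where a: "a = a' + x" using le(1) le_Suc_ex by blast
  obtain u where b: "b = b' + u" using le(2) le_Suc_ex by blast
  obtain v where c: "c = c' + v" using le(3) le_Suc_ex by blast
  define Y where "Y = load n a' (b' + x) (c' + u)"
  define Z where "Z = load n x (u + a') (v + b')"
  have sum: "load (Suc n) a b c = (Y + v) + (Z + c')"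
    unfolding load_def vol_rec a b c Y_def Z_def by (simp add: algebra_simps)
  have Y: "Y + v \<le> 2 ^ n" and Z: "Z + c' \<le> 2 ^ n"
    using y z by (simp_all add: Y_def Z_def a b c)
  \<comment> \<open>Selecting this many of the last class lifts the yes side to exactly
    \<open>2 ^ n\<close>; by conservation the others do the same for the no side.\<close>
  define d' where "d' = 2 ^ n - (Y + v)"
  have d: "2 ^ Suc n - load (Suc n) a b c = d' + (2 ^ n - (Z + c'))"
    unfolding sum d'_def using Y Z by simp
  have "wins n a' (b' + x) (c' + u) (d' + v)" "wins n x (u + a') (v + b') (2 ^ n - (Z + c') + c')"
    using assms(6,7) Y Z unfolding tight_wins_def d'_def by (simp_all add: a b c Y_def Z_def)
  then have "wins (Suc n) a b c (d' + (2 ^ n - (Z + c')))"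
    unfolding wins.simps
    by (intro exI[of _ a'] exI[of _ b'] exI[of _ c'] exI[of _ d']) (simp add: a b c)
  moreover have "load (Suc n) a b c \<le> 2 ^ Suc n" using Y Z by (simp add: sum)
  ultimately show ?thesis unfolding tight_wins_def prod.case d by blast
qed

text \<open>A table entry is a state together with the part of its first three classes put into the question;
  \<open>levels_ok\<close> carries the current values of \<open>vol 3\<close>, \<open>vol 2\<close>, \<open>vol 1\<close> and \<open>2 ^ n\<close> along.\<close>

type_synonym entry = "(nat \<times> nat \<times> nat) \<times> (nat \<times> nat \<times> nat)"

definition entry_ok ::
    "nat \<Rightarrow> nat \<Rightarrow> nat \<Rightarrow> nat \<Rightarrow> (nat \<times> nat \<times> nat) list \<Rightarrow> entry \<Rightarrow> bool" where
  "entry_ok w3 w2 w1 p prev e = (case e of ((a, b, c), (a', b', c')) \<Rightarrow>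
     a' \<le> a \<and> b' \<le> b \<and> c' \<le> c \<and>
     (let ay = a'; by = b' + (a - a'); cy = c' + (b - b');
          an = a - a'; bn = b - b' + a'; cn = c - c' + b'
      in ay * w3 + by * w2 + cy * w1 + (c - c') \<le> p \<and> an * w3 + bn * w2 + cn * w1 + c' \<le> p \<and>
         (ay, by, cy) \<in> set prev \<and> (an, bn, cn) \<in> set prev))"

fun levels_ok ::
    "nat \<Rightarrow> nat \<Rightarrow> nat \<Rightarrow> nat \<Rightarrow> (nat \<times> nat \<times> nat) list \<Rightarrow> entry list list \<Rightarrow> bool" where
  "levels_ok w3 w2 w1 p prev [] = True"
| "levels_ok w3 w2 w1 p prev (lv # lvs) =
     (list_all (entry_ok w3 w2 w1 p prev) lv \<and>
      levels_ok (w3 + w2) (w2 + w1) (w1 + 1) (2 * p) (map fst lv) lvs)"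

lemma entry_ok_tight_wins:
  assumes "entry_ok (vol 3 n) (vol 2 n) (vol 1 n) (2 ^ n) prev e" "\<forall>t \<in> set prev. tight_wins n t"
  shows "tight_wins (Suc n) (fst e)"
proof -
  obtain a b c a' b' c' where e: "e = ((a, b, c), (a', b', c'))" by (metis surj_pair)
  have "a' \<le> a \<and> b' \<le> b \<and> c' \<le> c \<and>
      load n a' (b' + (a - a')) (c' + (b - b')) + (c - c') \<le> 2 ^ n \<and>
      load n (a - a') (b - b' + a') (c - c' + b') + c' \<le> 2 ^ n \<and>
      (a', b' + (a - a'), c' + (b - b')) \<in> set prev \<and> (a - a', b - b' + a', c - c' + b') \<in> set prev"
    using assms(1) unfolding e entry_ok_def load_def Let_def prod.case .
  then show ?thesis
    unfolding e fst_conv using assms(2) by (blast intro: tight_wins_Suc)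
qed

lemma levels_ok_tight_wins:
  assumes "levels_ok (vol 3 n) (vol 2 n) (vol 1 n) (2 ^ n) prev lvs" "\<forall>t \<in> set prev. tight_wins n t"
    "i < length lvs" "t \<in> fst ` set (lvs ! i)"
  shows "tight_wins (Suc (n + i)) t"
  using assms
proof (induction lvs arbitrary: n prev i)
  case (Cons lv lvs)
  have *: "\<forall>t \<in> set (map fst lv). tight_wins (Suc n) t"
    using entry_ok_tight_wins Cons.prems(1,2) by (fastforce simp: list_all_iff)
  show ?case
  proof (cases i)
    case 0
    then show ?thesis using * Cons.prems(4) by auto
  next
    case (Suc j)
    have "levels_ok (vol 3 (Suc n)) (vol 2 (Suc n)) (vol 1 (Suc n)) (2 ^ Suc n) (map fst lv) lvs"
      using Cons.prems(1) by (simp only: levels_ok.simps vol_rec power_Suc)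
    from Cons.IH[OF this *, of j] show ?thesis using Cons.prems(3,4) Suc by simp
  qed
qed simp

text \<open>Level \<open>i\<close> (counted from 0) lists states with \<open>i + 1\<close> questions left.\<close>

definition strategy_table :: "entry list list" where
  "strategy_table = [
   [((0,0,0),(0,0,0)),((0,0,1),(0,0,1)),((0,1,0),(0,1,0)),((1,0,0),(1,0,0))],
   [((0,0,0),(0,0,0)),((0,0,1),(0,0,1)),((0,1,0),(0,1,0)),((1,0,0),(1,0,0))],
   [((0,0,0),(0,0,0)),((0,0,1),(0,0,1)),((0,0,2),(0,0,1)),((0,1,0),(0,1,0)),((1,0,0),(1,0,0))],
   [((0,0,0),(0,0,0)),((0,0,1),(0,0,1)),((0,0,2),(0,0,1)),((0,1,0),(0,1,0)),((0,1,1),(0,1,0)),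
    ((1,0,0),(1,0,0))],
   [((0,0,0),(0,0,0)),((0,0,1),(0,0,1)),((0,0,3),(0,0,2)),((0,0,4),(0,0,2)),((0,1,0),(0,1,0)),
    ((0,1,1),(0,1,1)),((0,2,0),(0,1,0)),((1,0,0),(1,0,0)),((1,0,1),(1,0,0))],
   [((0,0,0),(0,0,0)),((0,0,1),(0,0,1)),((0,0,3),(0,0,3)),((0,0,4),(0,0,3)),((0,0,6),(0,0,3)),
    ((0,0,7),(0,0,4)),((0,1,0),(0,1,0)),((0,1,1),(0,1,1)),((0,1,2),(0,1,0)),((0,1,3),(0,1,1)),
    ((0,1,4),(0,1,1)),((1,0,0),(1,0,0)),((1,0,1),(1,0,1)),((1,1,0),(1,0,0))],
   [((0,0,0),(0,0,0)),((0,0,1),(0,0,1)),((0,0,2),(0,0,1)),((0,0,4),(0,0,3)),((0,0,5),(0,0,4)),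
    ((0,0,6),(0,0,3)),((0,0,8),(0,0,4)),((0,1,0),(0,1,0)),((0,1,1),(0,1,1)),((0,1,2),(0,1,2)),
    ((0,1,3),(0,1,1)),((0,1,6),(0,1,4)),((0,1,8),(0,1,3)),((0,1,9),(0,1,4)),((0,1,10),(0,1,4)),
    ((0,2,2),(0,1,1)),((0,2,4),(0,1,2)),((0,2,5),(0,1,3)),((0,2,6),(0,1,3)),((1,0,0),(1,0,0)),
    ((1,0,1),(1,0,1)),((1,0,3),(1,0,1)),((1,0,5),(1,0,1))],
   [((0,0,0),(0,0,0)),((0,0,1),(0,0,1)),((0,0,2),(0,0,1)),((0,0,3),(0,0,2)),((0,0,4),(0,0,2)),
    ((0,0,5),(0,0,4)),((0,0,6),(0,0,4)),((0,0,7),(0,0,5)),((0,0,8),(0,0,4)),((0,0,10),(0,0,5)),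
    ((0,0,11),(0,0,6)),((0,0,13),(0,0,8)),((0,1,0),(0,1,0)),((0,1,1),(0,1,1)),((0,1,2),(0,1,1)),
    ((0,1,3),(0,1,3)),((0,1,4),(0,1,3)),((0,1,5),(0,1,2)),((0,1,6),(0,1,3)),((0,1,7),(0,1,3)),
    ((0,1,9),(0,1,6)),((0,1,10),(0,1,6)),((0,1,11),(0,1,6)),((0,1,13),(0,1,6)),
    ((0,2,0),(0,1,0)),((0,2,1),(0,1,1)),((0,2,2),(0,1,1)),((0,2,3),(0,1,2)),((0,2,4),(0,1,2)),
    ((0,2,5),(0,2,2)),((0,2,6),(0,2,4)),((0,2,7),(0,1,5)),((0,2,13),(0,1,8)),((0,2,14),(0,1,7)),
    ((0,3,7),(0,2,3)),((0,3,11),(0,2,5)),((0,3,12),(0,2,5)),((0,3,13),(0,2,5)),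
    ((0,4,4),(0,2,2)),((1,0,0),(1,0,0)),((1,0,1),(1,0,1)),((1,0,2),(1,0,1)),((1,0,3),(1,0,1)),
    ((1,0,4),(1,0,1)),((1,0,5),(1,0,3)),((1,0,6),(1,0,3)),((1,0,7),(1,0,5)),((1,0,13),(1,0,5)),
    ((1,1,6),(1,0,4)),((1,1,9),(1,0,4)),((1,1,10),(1,0,4))],
   [((0,0,7),(0,0,4)),((0,0,8),(0,0,4)),((0,0,9),(0,0,5)),((0,0,11),(0,0,6)),((0,0,12),(0,0,6)),
    ((0,0,13),(0,0,7)),((0,0,15),(0,0,8)),((0,0,16),(0,0,8)),((0,0,18),(0,0,10)),
    ((0,1,8),(0,1,4)),((0,1,11),(0,1,6)),((0,1,14),(0,1,7)),((0,1,15),(0,1,9)),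
    ((0,1,17),(0,1,7)),((0,1,18),(0,1,9)),((0,1,19),(0,1,9)),((0,1,20),(0,1,11)),
    ((0,1,21),(0,1,11)),((0,1,23),(0,1,11)),((0,1,25),(0,1,13)),((0,2,17),(0,1,9)),
    ((0,2,21),(0,1,12)),((0,2,22),(0,1,12)),((0,2,24),(0,1,12)),((0,2,25),(0,2,14)),
    ((0,4,23),(0,2,12)),((0,5,21),(0,3,11)),((0,6,17),(0,3,9)),((1,1,17),(1,1,9)),
    ((1,1,20),(1,1,10)),((1,2,7),(1,1,5)),((1,2,9),(1,1,5)),((1,2,24),(1,0,11)),
    ((1,3,10),(1,1,4)),((1,3,13),(1,1,7)),((1,3,19),(1,1,8)),((1,4,6),(1,1,3))],
   [((0,0,14),(0,0,7)),((0,0,15),(0,0,8)),((0,0,16),(0,0,8)),((0,0,17),(0,0,9)),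
    ((0,0,18),(0,0,9)),((0,0,20),(0,0,11)),((0,0,21),(0,0,12)),((0,0,22),(0,0,11)),
    ((0,0,25),(0,0,13)),((0,0,26),(0,0,13)),((0,0,27),(0,0,15)),((0,0,30),(0,0,15)),
    ((0,1,15),(0,1,8)),((0,1,19),(0,1,11)),((0,1,21),(0,1,11)),((0,1,23),(0,1,11)),
    ((0,1,26),(0,1,14)),((0,1,27),(0,1,15)),((0,1,30),(0,1,15)),((0,1,31),(0,1,17)),
    ((0,1,34),(0,1,17)),((0,1,35),(0,1,18)),((0,2,35),(0,1,18)),((0,2,36),(0,1,18)),
    ((0,2,37),(0,1,20)),((0,2,39),(0,1,20)),((0,2,40),(0,1,20)),((0,3,31),(0,2,16)),
    ((0,3,39),(0,2,20)),((0,3,42),(0,2,21)),((0,4,43),(0,2,23)),((0,5,43),(0,4,22)),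
    ((0,7,39),(0,5,19)),((1,2,16),(1,2,7)),((1,2,18),(1,2,9)),((1,2,32),(1,1,16)),
    ((1,2,39),(1,1,19)),((1,3,21),(1,3,10)),((1,3,25),(1,3,13)),((1,3,35),(1,3,19)),
    ((1,4,39),(1,3,18)),((1,5,42),(1,2,21)),((1,6,39),(1,2,20)),((1,8,28),(1,3,14))],
   [((0,0,28),(0,0,14)),((0,0,29),(0,0,15)),((0,0,35),(0,0,18)),((0,0,36),(0,0,18)),
    ((0,0,42),(0,0,22)),((0,0,43),(0,0,22)),((0,1,30),(0,1,15)),((0,1,31),(0,1,15)),
    ((0,1,35),(0,1,19)),((0,1,38),(0,1,19)),((0,1,42),(0,1,21)),((0,1,43),(0,1,23)),
    ((0,1,44),(0,1,23)),((0,1,50),(0,1,26)),((0,1,51),(0,1,26)),((0,1,52),(0,1,26)),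
    ((0,1,59),(0,1,30)),((0,2,51),(0,1,26)),((0,2,58),(0,1,29)),((0,2,59),(0,1,30)),
    ((0,2,60),(0,1,30)),((0,2,67),(0,1,34)),((0,2,68),(0,1,34)),((0,3,67),(0,2,34)),
    ((0,3,68),(0,2,35)),((0,4,69),(0,2,35)),((0,4,74),(0,2,37)),((0,4,75),(0,2,38)),
    ((0,5,74),(0,3,37)),((0,6,75),(0,3,39)),((0,9,77),(0,5,39)),((1,2,29),(1,2,16)),
    ((1,2,35),(1,2,18)),((1,3,41),(1,3,21)),((1,3,52),(1,3,25)),((1,4,59),(1,2,30)),
    ((1,4,68),(1,3,34)),((1,4,74),(1,2,37)),((1,7,75),(1,4,36)),((1,9,76),(1,5,38)),
    ((1,12,66),(1,6,33))],
   [((0,0,57),(0,0,29)),((0,0,58),(0,0,29)),((0,1,57),(0,1,30)),((0,1,58),(0,1,30)),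
    ((0,1,69),(0,1,35)),((0,1,70),(0,1,35)),((0,1,83),(0,1,42)),((0,1,84),(0,1,42)),
    ((0,2,59),(0,1,30)),((0,2,71),(0,1,37)),((0,2,83),(0,1,42)),((0,2,86),(0,1,43)),
    ((0,2,98),(0,1,49)),((0,2,99),(0,1,50)),((0,3,99),(0,2,50)),((0,3,100),(0,2,50)),
    ((0,3,114),(0,2,57)),((0,3,115),(0,2,58)),((0,4,114),(0,2,57)),((0,4,115),(0,2,58)),
    ((0,5,129),(0,3,65)),((0,5,130),(0,3,65)),((0,6,129),(0,3,65)),((0,8,141),(0,4,71)),
    ((0,9,140),(0,5,70)),((0,12,138),(0,6,69)),((1,2,58),(1,2,29)),((1,2,68),(1,2,35)),
    ((1,3,82),(1,3,41)),((1,4,99),(1,3,51)),((1,5,114),(1,4,58)),((1,7,130),(1,4,65)),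
    ((1,8,140),(1,4,70)),((1,12,138),(1,7,70)),((1,17,136),(1,9,68))],
   [((0,1,113),(0,1,57)),((0,1,114),(0,1,57)),((0,2,114),(0,1,57)),((0,2,137),(0,1,69)),
    ((0,2,138),(0,1,69)),((0,3,138),(0,2,70)),((0,3,163),(0,2,82)),((0,3,164),(0,2,82)),
    ((0,4,165),(0,2,84)),((0,4,192),(0,2,96)),((0,4,193),(0,2,97)),((0,5,192),(0,3,97)),
    ((0,5,193),(0,3,98)),((0,6,194),(0,3,97)),((0,7,221),(0,4,111)),((0,7,222),(0,4,111)),
    ((0,8,221),(0,4,111)),((0,11,247),(0,6,124)),((0,11,248),(0,6,124)),((0,17,264),(0,9,132)),
    ((1,3,114),(1,2,57)),((1,3,136),(1,2,67)),((1,4,164),(1,3,81)),((1,6,193),(1,4,97)),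
    ((1,8,221),(1,5,111)),((1,12,247),(1,7,125)),((1,16,264),(1,8,132)),((1,23,253),(1,12,127))],
   [((0,2,224),(0,1,112)),((0,3,224),(0,2,113)),((0,3,225),(0,2,113)),((0,4,270),(0,2,135)),
    ((0,4,272),(0,2,136)),((0,5,271),(0,3,136)),((0,6,321),(0,3,161)),((0,6,322),(0,3,161)),
    ((0,7,322),(0,4,162)),((0,9,375),(0,5,188)),((0,9,376),(0,5,188)),((0,10,375),(0,5,188)),
    ((0,14,428),(0,7,214)),((0,15,428),(0,8,214)),((0,22,473),(0,11,237)),((1,4,224),(1,3,113)),
    ((1,5,269),(1,3,134)),((1,7,322),(1,4,161)),((1,11,376),(1,6,188)),((1,15,427),(1,8,214)),
    ((1,22,473),(1,12,237)),((1,32,496),(1,16,248))],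
   [((0,5,443),(0,3,222)),((0,5,444),(0,3,223)),((0,6,443),(0,3,222)),((0,6,444),(0,3,222)),
    ((0,8,532),(0,4,266)),((0,9,534),(0,5,267)),((0,12,631),(0,6,316)),((0,12,632),(0,6,316)),
    ((0,13,631),(0,7,316)),((0,19,731),(0,10,366)),((0,19,732),(0,10,366)),
    ((0,29,827),(0,15,414)),((1,6,443),(1,4,222)),((1,9,531),(1,5,265)),((1,13,631),(1,7,316)),
    ((1,20,731),(1,11,367)),((1,29,826),(1,15,413)),((1,43,903),(1,22,452))],
   [((0,10,876),(0,5,438)),((0,10,877),(0,5,439)),((0,11,876),(0,6,438)),((0,11,877),(0,6,439)),
    ((0,16,1048),(0,8,524)),((0,17,1049),(0,9,526)),((0,25,1237),(0,13,619)),
    ((0,25,1238),(0,13,619)),((0,38,1425),(0,19,713)),((1,11,876),(1,6,438)),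
    ((1,17,1048),(1,9,523)),((1,25,1237),(1,13,619)),((1,38,1425),(1,20,713)),
    ((1,57,1596),(1,29,798))],
   [((0,20,1733),(0,10,867)),((0,21,1732),(0,11,866)),((0,21,1733),(0,11,867)),
    ((0,32,2064),(0,16,1032)),((0,50,2425),(0,25,1213)),((1,21,1732),(1,11,866)),
    ((1,33,2064),(1,17,1032)),((1,49,2426),(1,25,1213)),((1,75,2775),(1,38,1388))],
   [((0,41,3424),(0,21,1712)),((0,42,3424),(0,21,1712)),((0,64,4064),(0,32,2032)),
    ((1,41,3423),(1,21,1712)),((1,64,4064),(1,33,2033)),((1,98,4753),(1,49,2377))],
   [((0,83,6765),(0,42,3383)),((1,82,6765),(1,41,3382)),((1,127,8001),(1,64,4001))],
   [((1,164,13366),(1,82,6683))]]"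

text \<open>The starting list has all triples of weight at most 1 with no question left, where
  \<open>vol 3\<close>, \<open>vol 2\<close>, \<open>vol 1\<close> and \<open>2 ^ n\<close> are all
  1.\<close>

lemma strategy_table_ok:
  "levels_ok 1 1 1 1 [(0,0,0),(0,0,1),(0,1,0),(1,0,0)] strategy_table"
  by code_simp

lemma table_tight_wins:
  assumes "n < length strategy_table" "t \<in> fst ` set (strategy_table ! n)"
  shows "tight_wins (Suc n) t"
proof -
  have "levels_ok (vol 3 0) (vol 2 0) (vol 1 0) (2 ^ 0) [(0,0,0),(0,0,1),(0,1,0),(1,0,0)] strategy_table"
    using strategy_table_ok by simp
  from levels_ok_tight_wins[OF this, of n t] show ?thesis
    using assms by (simp add: tight_wins_def load_def)
qed

section \<open>Halving with many questions left\<close>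

text \<open>From 21 on, one step at most doubles the cube. At 21 the sides are 2037420 and 2097152,
  and at 20 the inequality fails. The factor satisfies \<open>20 ^ 3 * 6 \<le> 220 ^ 2\<close>, as
  the third bound of \<open>cube_root_bounds\<close> requires.\<close>

lemma cube_le_power_two:
  assumes "21 \<le> (N::nat)"
  shows "220 * N ^ 3 \<le> 2 ^ N"
  using assms
proof (induction N rule: nat_induct_at_least)
  case (Suc n)
  have "Suc n ^ 3 = n * n * n + 3 * (n * n) + 3 * n + 1"
    by (simp add: power3_eq_cube algebra_simps)
  moreover have "21 * (n * n) \<le> n * n * n" "21 * 21 \<le> n * n" "21 * n \<le> n * n"
    using Suc.hyps mult_le_mono[OF Suc.hyps Suc.hyps] by simp_all
  ultimately have "Suc n ^ 3 \<le> 2 * n ^ 3" unfolding power3_eq_cube[of n] by linarith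
  then show ?case using Suc.IH by simp
qed simp

text \<open>The cubic is \<open>6 * P\<close> for the \<open>P\<close> of
  \<open>load_budget\<close>, so this means that \<open>P\<close> is at most 13/25 of
  \<open>2 ^ n\<close>. At 8 the share is still about 0.8.\<close>

lemma cubic_le_power_two:
  assumes "9 \<le> (n::nat)"
  shows "25 * (n * n * n + 6 * (n * n) + 35 * n + 60) \<le> 78 * 2 ^ n"
  using assms
proof (induction n rule: nat_induct_at_least)
  case (Suc n)
  have "9 * (n * n) \<le> n * n * n" "9 * 9 \<le> n * n" "9 * n \<le> n * n"
    using Suc.hyps mult_le_mono[OF Suc.hyps Suc.hyps] by simp_all
  then show ?case using Suc by (simp add: algebra_simps)
qed simp

text \<open>\<open>M\<close> is at most the cube root of \<open>6 * 2 ^ N\<close>, so all three left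
  sides grow more slowly than \<open>2 ^ N\<close>. Both sides are cubed, which turns the hypothesis
  on \<open>M\<close> and \<open>cube_le_power_two\<close> into the only facts required.\<close>

lemma cube_root_bounds:
  assumes N: "21 \<le> (N::nat)" and M: "M ^ 3 \<le> 6 * (2::nat) ^ N"
  shows "38 * (M * M) \<le> 2 ^ N" "3 * (N + 2) * (M * M) \<le> 2 * 2 ^ N" "20 * (N * N) * M \<le> 2 ^ N"
proof -
  define x :: nat where "x = 2 ^ N"
  have cube: "220 * N ^ 3 \<le> x" unfolding x_def by (rule cube_le_power_two[OF N])
  have M2: "(M * M) ^ 3 \<le> 36 * x ^ 2"
    using power_mono[OF M, of 2] by (simp add: x_def power_mult_distrib power2_eq_square power3_eq_cube)
  have "(21::nat) ^ 3 \<le> N ^ 3" using N by (intro power_mono) auto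
  then have x: "220 * 21 ^ 3 \<le> x" using cube by linarith
  have "(38 * (M * M)) ^ 3 = 38 ^ 3 * (M * M) ^ 3" by (rule power_mult_distrib)
  also have "\<dots> \<le> 38 ^ 3 * (36 * x ^ 2)" using M2 by simp
  also have "\<dots> = (38 ^ 3 * 36) * x ^ 2" by simp
  also have "\<dots> \<le> x * x ^ 2" using x by (intro mult_right_mono) auto
  finally have "(38 * (M * M)) ^ 3 \<le> x ^ 3" by (simp add: power3_eq_cube power2_eq_square)
  then show "38 * (M * M) \<le> 2 ^ N" unfolding x_def[symmetric] by (rule power_le_imp_le_base[of _ 2, simplified]) simp
  have "21 * (N + 2) \<le> 23 * N" using N by simp
  then have "(21 * (N + 2)) ^ 3 \<le> (23 * N) ^ 3" by (intro power_mono) auto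
  then have "21 ^ 3 * (N + 2) ^ 3 \<le> 23 ^ 3 * N ^ 3" by (simp only: power_mult_distrib)
  then have N2: "972 * (N + 2) ^ 3 \<le> 8 * x" using cube by simp
  have "(3 * (N + 2) * (M * M)) ^ 3 = 3 ^ 3 * (N + 2) ^ 3 * (M * M) ^ 3"
    by (simp only: power_mult_distrib)
  also have "\<dots> \<le> 3 ^ 3 * (N + 2) ^ 3 * (36 * x ^ 2)" using M2 by simp
  also have "\<dots> = (972 * (N + 2) ^ 3) * x ^ 2" by simp
  also have "\<dots> \<le> (8 * x) * x ^ 2" using N2 by (intro mult_right_mono) auto
  finally have "(3 * (N + 2) * (M * M)) ^ 3 \<le> (2 * x) ^ 3" by (simp add: power3_eq_cube power2_eq_square)
  then show "3 * (N + 2) * (M * M) \<le> 2 * 2 ^ N"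
    unfolding x_def[symmetric] by (rule power_le_imp_le_base[of _ 2, simplified]) simp
  have "(20 * (N * N) * M) ^ 3 = 8000 * (N ^ 3) ^ 2 * M ^ 3"
    by (simp add: power_mult_distrib power2_eq_square power3_eq_cube)
  also have "\<dots> \<le> 8000 * (N ^ 3) ^ 2 * (6 * x)" using M by (intro mult_left_mono) (simp_all add: x_def)
  also have "\<dots> \<le> (220 * N ^ 3) ^ 2 * x" by (simp add: power_mult_distrib)
  also have "\<dots> \<le> x ^ 2 * x" using power_mono[OF cube, of 2] by (intro mult_right_mono) auto
  finally have "(20 * (N * N) * M) ^ 3 \<le> x ^ 3" by (simp add: power3_eq_cube power2_eq_square)
  then show "20 * (N * N) * M \<le> 2 ^ N"
    unfolding x_def[symmetric] by (rule power_le_imp_le_base[of _ 2, simplified]) simp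
qed

text \<open>The left side is \<open>2 ^ (N - n)\<close> times the extreme weight in
  \<open>halving_region\<close>, including what enters the last class. In the first bracket 2, 4 and
  3 are accumulated rounding errors in class 1, in class 2 and in that last share; \<open>C\<close>
  stands for \<open>M choose 2\<close>.\<close>

lemma load_budget:
  assumes N: "21 \<le> N" and M: "M ^ 3 \<le> 6 * (2::nat) ^ N" and n: "8 \<le> n" "n < N"
    and C: "2 * C \<le> M * M"
  shows "2 ^ (N - n) * (vol 3 n + 2 * vol 2 n + 4 * (n + 1) + 3) + M * vol 2 n + (C + (N - n) * M) * (n + 2)
    \<le> 2 ^ N"
proof -
  define x :: nat where "x = 2 ^ N"
  define K :: nat where "K = 2 ^ (N - n)"
  have x: "x = K * 2 ^ n" using n by (simp add: x_def K_def flip: power_add)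
  note b = cube_root_bounds[OF N M, folded x_def]
  define P where "P = vol 3 n + 2 * vol 2 n + 4 * (n + 1) + 3"
  have P: "6 * P = n * n * n + 6 * (n * n) + 35 * n + 60"
    using vol_2[of n] vol_3[of n] by (simp add: P_def)
  have NM: "21 * (N * M) \<le> N * N * M" "21 * 21 * M \<le> N * N * M"
    using N mult_le_mono[OF N N] by simp_all
  have "K * P + M * vol 2 n + (C + (N - n) * M) * (n + 2) \<le> x"
  \<comment> \<open>At 8 the rounding part uses 13/16 of the budget, too much for the general
    estimate. But there \<open>n + 2\<close> is just 10, so the term with \<open>C\<close> costs at
    most 5/38 of it.\<close>
  proof (cases "n = 8")
    case True
    have "16 * (K * P) \<le> 13 * x" using P by (simp add: True x)
    moreover have "M * vol 2 n = 37 * M" using vol_2[of n] by (simp add: True)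
    moreover have "(N - n) * M \<le> N * M" by simp
    moreover have "20 * (N * N * M) \<le> x" using b(3) by (simp add: algebra_simps)
    moreover have "(C + (N - n) * M) * (n + 2) = 10 * C + 10 * ((N - n) * M)" by (simp add: True)
    ultimately show ?thesis using b(1) NM C by linarith
  next
    case False
    have "25 * P \<le> 13 * 2 ^ n" using cubic_le_power_two[of n] n False P by simp
    then have KP: "25 * (K * P) \<le> 13 * x" unfolding x by (metis mult.left_commute mult_le_mono2)
    have "2 * vol 2 n \<le> N * N + N + 2" using n vol_2[of n] by (simp add: add_mono mult_le_mono)
    from mult_le_mono2[OF this, of M] have v: "2 * (M * vol 2 n) \<le> N * N * M + N * M + 2 * M"
      by (simp add: algebra_simps)
    have "(C + (N - n) * M) * (n + 2) \<le> (C + N * M) * (N + 2)"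
      using n by (intro mult_le_mono) auto
    also have "2 * \<dots> = 2 * C * (N + 2) + 2 * (N * M) * (N + 2)" by (simp add: algebra_simps)
    also have "\<dots> \<le> M * M * (N + 2) + 2 * (N * M) * (N + 2)" using mult_le_mono1[OF C, of "N + 2"] by simp
    finally have c: "2 * ((C + (N - n) * M) * (n + 2)) \<le> M * M * (N + 2) + 2 * (N * N * M) + 4 * (N * M)"
      by (simp add: algebra_simps)
    have b2: "3 * (M * M * (N + 2)) \<le> 2 * x" using b(2) by (simp add: algebra_simps)
    have b3: "20 * (N * N * M) \<le> x" using b(3) by (simp add: algebra_simps)
    show ?thesis using KP v c b2 b3 NM by linarith
  qed
  then show ?thesis by (simp add: P_def K_def x_def)
qed

text \<open>An upper bound for the states that halving reaches from \<open>(1, M, M choose 2)\<close> when \<open>n\<close> of the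
  \<open>N\<close> questions are left.\<close>

definition halving_region :: "nat \<Rightarrow> nat \<Rightarrow> nat \<Rightarrow> nat \<Rightarrow> nat \<Rightarrow> nat \<Rightarrow> bool" where
  "halving_region N M n a b c \<longleftrightarrow> a \<le> 1 \<and>
     2 ^ (N - n) * b \<le> (if a = 1 then M else M + 2 * 2 ^ (N - n)) \<and>
     2 ^ (N - n) * c \<le> (M choose 2) + (N - n) * M + 4 * 2 ^ (N - n)"

lemma twice_choose_2: "2 * (M choose 2) \<le> M * M"
proof -
  have "2 * (M choose 2) \<le> M * (M - 1)" unfolding choose_two by (rule times_div_less_eq_dividend)
  also have "\<dots> \<le> M * M" by simp
  finally show ?thesis .
qed

text \<open>\<open>e\<close> is room for the candidates that an answer moves from class 2 into the
  last class, as in both weight premises of \<open>tight_wins_Suc\<close>.\<close>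

lemma load_halving_region:
  assumes "21 \<le> N" "M ^ 3 \<le> 6 * 2 ^ N" "8 \<le> n" "n < N" "halving_region N M n a b c"
    and e: "2 ^ (N - n) * e \<le> (M choose 2) + (N - n) * M + 3 * 2 ^ (N - n)"
  shows "load n a b c + e \<le> 2 ^ n"
proof -
  define K :: nat where "K = 2 ^ (N - n)"
  define X where "X = (M choose 2) + (N - n) * M"
  have a: "a \<le> 1" and b: "K * b \<le> M + 2 * K" and c: "K * c \<le> X + 4 * K"
    using assms(5) by (auto simp: halving_region_def K_def X_def split: if_splits)
  have e: "K * e \<le> X + 3 * K" using e by (simp add: K_def X_def)
  have "K * (load n a b c + e) = K * a * vol 3 n + K * b * vol 2 n + K * c * (n + 1) + K * e"
    by (simp add: load_def vol_1 algebra_simps)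
  also have "\<dots> \<le> K * vol 3 n + (M + 2 * K) * vol 2 n + (X + 4 * K) * (n + 1) + (X + 3 * K)"
    by (intro add_mono mult_le_mono b c e) (use a in auto)
  also have "\<dots> = K * (vol 3 n + 2 * vol 2 n + 4 * (n + 1) + 3) + M * vol 2 n + X * (n + 2)"
    by (simp add: algebra_simps)
  also have "\<dots> \<le> 2 ^ N"
    unfolding K_def X_def by (rule load_budget) (use assms twice_choose_2 in auto)
  also have "\<dots> = K * 2 ^ n" using assms(4) by (simp add: K_def flip: power_add)
  finally show ?thesis by (simp add: K_def)
qed

text \<open>Index 7 means 8 questions left. That level contains the whole box of states in which
  halving can end.\<close>

lemma table_level_8:
  assumes "a = 1 \<and> b = 0 \<or> a = 0 \<and> b \<le> 2" "c \<le> 7"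
  shows "tight_wins 8 (a, b, c)"
proof -
  have tab: "\<forall>c\<in>set [0..<8]. (1, 0, c) \<in> set (map fst (strategy_table ! 7)) \<and>
     (\<forall>b\<in>set [0..<3]. (0, b, c) \<in> set (map fst (strategy_table ! 7)))" "7 < length strategy_table"
    by code_simp+
  have "c \<in> set [0..<8]" "a = 1 \<and> b = 0 \<or> a = 0 \<and> b \<in> set [0..<3]" using assms by auto
  then have "(a, b, c) \<in> set (map fst (strategy_table ! 7))"
    using tab(1) by blast
  then show ?thesis using table_tight_wins[of 7 "(a, b, c)"] tab(2) by simp
qed

text \<open>An excess from rounding is itself halved by the next question, so the allowances 2 and 4
  of \<open>halving_region\<close> reproduce themselves. As long as \<open>a = 1\<close>, class 1
  has only been rounded down; hence its bound has no allowance then.\<close>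

lemma tight_wins_halving:
  assumes "21 \<le> N" "M ^ 3 \<le> 6 * 2 ^ N" "8 \<le> n" "n \<le> N" "halving_region N M n a b c"
  shows "tight_wins n (a, b, c)"
  using assms(3-5)
proof (induction n arbitrary: a b c rule: nat_induct_at_least)
  case base
  define K :: nat where "K = 2 ^ (N - 8)"
  have x: "(2::nat) ^ N = 256 * K" using assms(1) power_add[of "2::nat" 8 "N - 8"] by (simp add: K_def)
  note bd = cube_root_bounds[OF assms(1,2), unfolded x]
  have NM: "21 * (N * M) \<le> N * N * M" "21 * 21 * M \<le> N * N * M" "(N - 8) * M \<le> N * M"
    using assms(1) mult_le_mono[OF assms(1) assms(1)] by simp_all
  have b3: "20 * (N * N * M) \<le> 256 * K" using bd(3) by (simp add: algebra_simps)
  have K: "0 < K" by (simp add: K_def)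
  \<comment> \<open>One candidate of class 1 counts \<open>K\<close> in the scaled bound, so there
    is room for none if \<open>a = 1\<close> and for two otherwise.\<close>
  have MK: "M < K" using b3 NM K by linarith
  have b: "a = 1 \<and> b = 0 \<or> a = 0 \<and> b \<le> 2"
  proof -
    have "a \<le> 1" "K * b \<le> (if a = 1 then M else M + 2 * K)"
      using base.prems by (auto simp: halving_region_def K_def)
    moreover have "b = 0" if "K * b \<le> M"
    proof (rule ccontr)
      assume "b \<noteq> 0"
      then have "K * 1 \<le> K * b" by (intro mult_le_mono) auto
      then show False using that MK by linarith
    qed
    moreover have "b \<le> 2" if "K * b \<le> M + 2 * K"
    proof (rule ccontr)
      assume "\<not> b \<le> 2"
      then have "K * 3 \<le> K * b" by (intro mult_le_mono) auto
      then show False using that MK by linarith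
    qed
    ultimately show ?thesis by (cases "a = 1") auto
  qed
  have "c \<le> 7"
  proof (rule ccontr)
    assume "\<not> c \<le> 7"
    then have "K * 8 \<le> K * c" by (intro mult_le_mono) auto
    moreover have "K * c \<le> (M choose 2) + (N - 8) * M + 4 * K"
      using base.prems by (simp add: halving_region_def K_def)
    \<comment> \<open>The margin is narrow: as \<open>2 ^ N = 256 * K\<close>, the bounds give less
      than \<open>3.37 * K\<close> for \<open>M choose 2\<close> and at most \<open>0.61 * K\<close>
      for \<open>N * M\<close>.\<close>
    ultimately have "4 * K \<le> (M choose 2) + N * M" using NM(3) by linarith
    then show False using twice_choose_2[of M] bd(1) b3 NM K by linarith
  qed
  then show ?case using table_level_8 b by blast
next
  case (Suc n)
  define K :: nat where "K = 2 ^ (N - Suc n)"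
  define k where "k = N - Suc n"
  have K2: "2 ^ (N - n) = 2 * K" and k: "N - n = Suc k"
    using Suc.prems(1) by (simp_all add: K_def k_def flip: power_Suc add: Suc_diff_Suc)
  have a: "a \<le> 1" and b: "K * b \<le> (if a = 1 then M else M + 2 * K)"
    and c: "K * c \<le> (M choose 2) + k * M + 4 * K"
    using Suc.prems(2) by (auto simp: halving_region_def K_def k_def)
  \<comment> \<open>The question takes the class-0 candidate, if it is still there, and the smaller
    halves of classes 1 and 2. So the answer that keeps \<open>a = 1\<close> rounds class 1
    down.\<close>
  define b' where "b' = b div 2"
  define c' where "c' = c div 2"
  have half: "2 * b' \<le> b" "2 * (b - b') \<le> b + 1" "2 * c' \<le> c" "2 * (c - c') \<le> c + 1"
    by (simp_all add: b'_def c'_def)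
  have h: "2 * (K * b') \<le> K * b" "2 * (K * (b - b')) \<le> K * b + K"
    "2 * (K * c') \<le> K * c" "2 * (K * (c - c')) \<le> K * c + K"
    using mult_le_mono2[OF half(1), of K] mult_le_mono2[OF half(2), of K]
      mult_le_mono2[OF half(3), of K] mult_le_mono2[OF half(4), of K]
    by (simp_all only: mult.left_commute[of K 2] distrib_left mult_1_right)
  have W: "halving_region N M n x u v \<longleftrightarrow> x \<le> 1 \<and> 2 * (K * u) \<le> (if x = 1 then M else M + 4 * K) \<and>
      2 * (K * v) \<le> (M choose 2) + k * M + M + 8 * K" for x u v
    unfolding halving_region_def K2 unfolding k by (simp add: algebra_simps)
  have Kb: "K * b \<le> M + 2 * K" "K * a \<le> K" "a = 1 \<Longrightarrow> K * b \<le> M" "a \<noteq> 1 \<Longrightarrow> K * a = 0"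
    using a b by (auto split: if_splits)
  have y: "halving_region N M n a b' (c' + (b - b'))"
    unfolding W distrib_left using a Kb(1,3) c h by (intro conjI; (split if_split)?; linarith)
  have z: "halving_region N M n 0 (b - b' + a) (c - c' + b')"
    unfolding W distrib_left using a Kb c h
    by (intro conjI; cases "a = 1"; (subst if_not_P, simp)?; linarith)
  have n: "8 \<le> n" "n < N" "n \<le> N" using Suc.hyps Suc.prems(1) by auto
  have e: "2 ^ (N - n) * (c - c') \<le> (M choose 2) + (N - n) * M + 3 * 2 ^ (N - n)"
    "2 ^ (N - n) * c' \<le> (M choose 2) + (N - n) * M + 3 * 2 ^ (N - n)"
    using h c unfolding K2 unfolding k mult.assoc mult_Suc by linarith+
  show ?case
  proof (rule tight_wins_Suc[of a _ b' _ c'])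
    show "load n a (b' + (a - a)) (c' + (b - b')) + (c - c') \<le> 2 ^ n"
      using load_halving_region[OF assms(1,2) n(1,2) y e(1)] by simp
    show "load n (a - a) (b - b' + a) (c - c' + b') + c' \<le> 2 ^ n"
      using load_halving_region[OF assms(1,2) n(1,2) z e(2)] by simp
    show "tight_wins n (a, b' + (a - a), c' + (b - b'))" using Suc.IH[OF n(3) y] by simp
    show "tight_wins n (a - a, b - b' + a, c - c' + b')" using Suc.IH[OF n(3) z] by simp
  qed (simp_all add: b'_def c'_def)
qed

section \<open>From padded states back to the initial state\<close>

lemma vol_3_mono: "i \<le> j \<Longrightarrow> vol 3 i \<le> vol 3 j"
  unfolding vol_def by (intro sum_mono binomial_right_mono)

text \<open>By \<open>vol_add\<close> the volume bound says that the padding has room for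
  \<open>M choose 3\<close> candidates; the rest is monotonicity. Hence one start per
  \<open>n\<close>, with \<open>M\<close> as large as possible, is enough.\<close>

lemma wins_of_tight_wins:
  assumes "tight_wins n (1, M, M choose 2)" "vol 3 (n + M) \<le> 2 ^ n" "m \<le> M"
  shows "wins n 1 m (m choose 2) (m choose 3)"
proof -
  have w: "wins n 1 M (M choose 2) (2 ^ n - load n 1 M (M choose 2))"
    using assms(1) by (simp add: tight_wins_def)
  have "M choose 3 \<le> 2 ^ n - load n 1 M (M choose 2)"
    using assms(2) unfolding vol_add load_def by simp
  then have "m choose 3 \<le> 2 ^ n - load n 1 M (M choose 2)"
    using binomial_right_mono[OF assms(3), of 3] by (rule order_trans[rotated])
  then show ?thesis using wins_mono[OF w] assms(3) by (simp add: binomial_right_mono)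
qed

lemma table_starts:
  assumes "10 \<le> n" "n \<le> 20"
  obtains M where "tight_wins n (1, M, M choose 2)" "vol 3 (n + M) \<le> 2 ^ n" "2 ^ n < vol 3 (n + M + 1)"
proof -
  \<comment> \<open>For \<open>n\<close> = 10, ..., 20 these are the largest \<open>M\<close> with
    \<open>vol 3 (n + M) \<le> 2 ^ n\<close>; the start \<open>(1, M, M choose 2)\<close> is the
    last entry of its level. \<open>V\<close> is \<open>6 * vol 3\<close>.\<close>
  define Ms :: "nat list" where "Ms = [8, 12, 17, 23, 32, 43, 57, 75, 98, 127, 164]"
  define V :: "nat \<Rightarrow> nat" where "V k = k * k * k + 5 * k + 6" for k
  have "\<forall>i \<in> set [0..<11]. let M = Ms ! i; n = i + 10 in
      (1, M, M * (M - 1) div 2) \<in> set (map fst (strategy_table ! (i + 9))) \<and> i + 9 < length strategy_table \<and>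
      V (n + M) \<le> 6 * 2 ^ n \<and> 6 * 2 ^ n < V (n + M + 1)"
    unfolding Ms_def V_def by code_simp
  moreover have "n - 10 \<in> set [0..<11]" using assms by auto
  ultimately have *: "let M = Ms ! (n - 10); n = n - 10 + 10 in
      (1, M, M * (M - 1) div 2) \<in> set (map fst (strategy_table ! (n - 10 + 9))) \<and>
      n - 10 + 9 < length strategy_table \<and> V (n + M) \<le> 6 * 2 ^ n \<and> 6 * 2 ^ n < V (n + M + 1)"
    by fastforce
  define M where "M = Ms ! (n - 10)"
  have n: "n - 10 + 10 = n" "n - 10 + 9 = n - 1" "Suc (n - 1) = n" using assms by auto
  have "(1, M, M choose 2) \<in> set (map fst (strategy_table ! (n - 1)))" "n - 1 < length strategy_table"
    "V (n + M) \<le> 6 * 2 ^ n" "6 * 2 ^ n < V (n + M + 1)"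
    using * unfolding Let_def n M_def choose_two by auto
  then show thesis
    using table_tight_wins[of "n - 1" "(1, M, M choose 2)"] vol_3[of "n + M"] vol_3[of "n + M + 1"] n(3)
    by (intro that[of M]) (simp_all add: V_def)
qed

lemma wins_after_halving:
  assumes "m \<noteq> 0" "m \<notin> {1, 2, 3, 5}" and v: "vol 3 (n + m) \<le> 2 ^ n"
  shows "wins n 1 m (m choose 2) (m choose 3)"
proof -
  have m: "4 \<le> m" "m = 4 \<or> 6 \<le> m" using assms(1,2) by auto
  have "9 \<le> n"
  proof (rule ccontr)
    assume "\<not> 9 \<le> n"
    then have "n \<in> set [0..<9]" by auto
    moreover have "\<forall>n \<in> set [0..<9::nat]. 6 * 2 ^ n < (n + 4) * (n + 4) * (n + 4) + 5 * (n + 4) + 6"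
      by code_simp
    ultimately have "6 * 2 ^ n < 6 * vol 3 (n + 4)" unfolding vol_3 by blast
    moreover have "vol 3 (n + 4) \<le> vol 3 (n + m)" using m by (intro vol_3_mono) simp
    ultimately show False using v by simp
  qed
  then consider "n = 9" | "10 \<le> n" "n \<le> 20" | "21 \<le> n" by linarith
  then show ?thesis
  proof cases
    case 1
    \<comment> \<open>The volume bound with 9 questions left also admits \<open>m = 5\<close>, since
      \<open>vol 3 14 = 470\<close>, but the table only provides \<open>(1, 4, 6)\<close>; this is
      where 5 has to be excluded.\<close>
    have "m = 4"
    proof (rule ccontr)
      assume "m \<noteq> 4"
      then have "vol 3 15 \<le> vol 3 (n + m)" using m 1 by (intro vol_3_mono) auto
      then show False using v vol_3[of 15] 1 by simp
    qed
    have "(1, 4, 6) \<in> set (map fst (strategy_table ! 8))" "8 < length strategy_table"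
      by code_simp+
    then have "tight_wins 9 (1, 4, 6)" using table_tight_wins[of 8 "(1, 4, 6)"] by simp
    then show ?thesis
      using v by (intro wins_of_tight_wins[of n m m]) (simp_all add: 1 \<open>m = 4\<close> choose_two)
  next
    case 2
    then obtain M where M: "tight_wins n (1, M, M choose 2)" "vol 3 (n + M) \<le> 2 ^ n" "2 ^ n < vol 3 (n + M + 1)"
      by (rule table_starts)
    have "m \<le> M"
    proof (rule ccontr)
      assume "\<not> m \<le> M"
      then have "vol 3 (n + M + 1) \<le> vol 3 (n + m)" by (intro vol_3_mono) simp
      then show False using M(3) v by simp
    qed
    then show ?thesis using M(1,2) wins_of_tight_wins by blast
  next
    case 3
    have "m ^ 3 \<le> (n + m) ^ 3" by (intro power_mono) auto
    also have "\<dots> \<le> 6 * vol 3 (n + m)" unfolding vol_3 power3_eq_cube by linarith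
    also have "\<dots> \<le> 6 * 2 ^ n" using v by simp
    finally have "tight_wins n (1, m, m choose 2)"
      using 3 by (intro tight_wins_halving[of n m]) (simp_all add: halving_region_def)
    then show ?thesis using v wins_of_tight_wins by blast
  qed
qed

lemma N_min_vol: "N_min m = (LEAST q. 2 ^ m * vol 3 q \<le> 2 ^ q)"
  by (simp add: N_min_def vol_def)

lemma N_min_exists: "2 ^ m * vol 3 (N_min m) \<le> 2 ^ N_min m"
  unfolding N_min_vol
proof (rule LeastI)
  \<comment> \<open>Any witness will do for \<open>LEAST\<close>; \<open>2 * r\<close> is far from
    minimal, but \<open>cube_le_power_two\<close> applies to \<open>r\<close>.\<close>
  define r where "r = m + 21"
  have r: "220 * r ^ 3 \<le> 2 ^ r" by (rule cube_le_power_two) (simp add: r_def)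
  have "r * 1 \<le> r * (r * r)" "1 \<le> r" by (simp_all add: r_def)
  moreover have "6 * vol 3 (2 * r) = 8 * (r * (r * r)) + 10 * r + 6" by (simp add: vol_3)
  moreover have "r ^ 3 = r * (r * r)" by (simp add: power3_eq_cube)
  ultimately have "6 * vol 3 (2 * r) \<le> 220 * r ^ 3" by linarith
  then have "vol 3 (2 * r) \<le> 2 ^ r" using r by simp
  moreover have "(2::nat) ^ m \<le> 2 ^ r" by (simp add: r_def)
  ultimately have "2 ^ m * vol 3 (2 * r) \<le> 2 ^ r * 2 ^ r" by (rule mult_le_mono[rotated])
  then show "2 ^ m * vol 3 (2 * r) \<le> 2 ^ (2 * r)" by (simp add: mult_2 power_add)
qed

lemma wins_initial:
  assumes "m \<notin> {2, 3, 5}"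
  shows "wins (N_min m) (2 ^ m) 0 0 0"
proof -
  have N: "2 ^ m * vol 3 (N_min m) \<le> 2 ^ N_min m" by (rule N_min_exists)
  have "1 \<le> vol 3 (N_min m)" using vol_3_mono[of 0 "N_min m"] by simp
  then have "(2::nat) ^ m * 1 \<le> 2 ^ m * vol 3 (N_min m)" by (rule mult_le_mono2)
  then have "(2::nat) ^ m \<le> 2 ^ N_min m" using N by linarith
  then have "m \<le> N_min m" by simp
  then obtain n where n: "N_min m = n + m" by (metis add.commute le_Suc_ex)
  have v: "vol 3 (n + m) \<le> 2 ^ n" using N by (simp add: n power_add)
  have "wins n 1 m (m choose 2) (m choose 3)"
  proof -
    consider "m = 0" | "m = 1" | "m \<noteq> 0" "m \<notin> {1, 2, 3, 5}" using assms by blast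
    then show ?thesis
    proof cases
      case 1
      have "wins n 1 0 0 0" by (rule wins_le_1) simp
      then show ?thesis by (simp add: 1 numeral_2_eq_2 numeral_3_eq_3)
    next
      case 2
      \<comment> \<open>This is an equality: two balls of radius 3 fill the 128 words of length 7,
        as in the perfect repetition code. After one halving 6 questions are left.\<close>
      have "2 ^ 1 * vol 3 7 \<le> 2 ^ (7::nat)" using vol_3[of 7] by simp
      then have "N_min m \<le> 7" unfolding N_min_vol 2 by (rule Least_le)
      then have "n \<in> set [0..<7]" using n 2 by auto
      moreover have "\<forall>n \<in> set [0..<6::nat]. 6 * 2 ^ n < (n + 1) * (n + 1) * (n + 1) + 5 * (n + 1) + 6"
        by code_simp
      then have "n \<notin> set [0..<6]"
        using v vol_3[of "n + m"] unfolding 2 by fastforce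
      ultimately have "n = 6" by auto
      have "(1, 1, 0) \<in> set (map fst (strategy_table ! 5))" "5 < length strategy_table"
        by code_simp+
      then have "tight_wins 6 (1, 1, 0)" using table_tight_wins[of 5 "(1, 1, 0)"] by simp
      then show ?thesis
        using v by (intro wins_of_tight_wins[of n m m]) (simp_all add: choose_two 2 \<open>n = 6\<close>)
    next
      case 3
      then show ?thesis using v by (rule wins_after_halving)
    qed
  qed
  then show ?thesis using wins_halving[of n m 0] by (simp add: n numeral_2_eq_2 numeral_3_eq_3)
qed

section \<open>Patterns of cyclic words\<close>

text \<open>What a question does to a run of equally labelled candidates: \<open>Pre\<close> and \<open>Suf\<close> select an initial or
  final part of the run, of unspecified and possibly zero length.\<close>

datatype pick = Out | In | Pre | Suf

fun marks :: "pick \<Rightarrow> bool list" where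
  "marks Out = [False]"
| "marks In = [True]"
| "marks Pre = [True, False]"
| "marks Suf = [False, True]"

fun pieces :: "nat list \<Rightarrow> pick list \<Rightarrow> (nat \<times> bool) list" where
  "pieces (c # cs) (k # ks) = map (Pair c) (marks k) @ pieces cs ks"
| "pieces _ _ = []"

text \<open>The labels after the answer yes. The answer no is a yes to the complement and is treated
  through \<open>flip_marks\<close>.\<close>

definition outcome :: "(nat \<times> bool) list \<Rightarrow> nat list" where
  "outcome S = filter (\<lambda>c. c < 4) (map (\<lambda>(c, f). if f then c else c + 1) S)"

definition flip_marks :: "(nat \<times> bool) list \<Rightarrow> (nat \<times> bool) list" where
  "flip_marks S = map (\<lambda>(c, f). (c, \<not> f)) S"

fun changes :: "'a list \<Rightarrow> nat" where
  "changes (x # y # xs) = (if x = y then 0 else 1) + changes (y # xs)"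
| "changes _ = 0"

definition cyclic_changes :: "'a list \<Rightarrow> nat" where
  "cyclic_changes xs = (if xs = [] then 0 else changes (last xs # xs))"

text \<open>Every word whose sequence of runs is \<open>cs\<close>, empty runs and equal neighbours allowed, is a word of the
  pattern \<open>ps\<close>.\<close>

fun spells :: "nat list \<Rightarrow> nat list \<Rightarrow> bool" where
  "spells [] ps = True"
| "spells (c # cs) [] = False"
| "spells (c # cs) (p # ps) = (if c = p then spells cs (p # ps) else spells (c # cs) ps)"

text \<open>\<open>Ask c I\<close> tests whether the runs with positions \<open>I\<close>, all labelled \<open>c\<close>, have together at
  most as many candidates as the question must select from class \<open>c\<close>. In \<open>Pick ks y n\<close> the targets
  \<open>y\<close> and \<open>n\<close> consist of a pattern index, a rotation and whether to reflect.\<close>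

datatype plan = Ask nat "nat list" plan plan | Pick "pick list" "nat \<times> nat \<times> bool" "nat \<times> nat \<times> bool"

text \<open>These patterns, and the plans below, were found by computer search.\<close>

definition shapes :: "nat list list" where
  "shapes =
    [[0,1,2,1,3,2,3,2],
     [0,1,2,3,1,2,3,2],
     [0,1,2,3,1,3,1],
     [0,1,2,3,2,1,3,2],
     [0,1,2,3,2,3,1,2],
     [0,1,3,1,2,3,1],
     [0,1,3,2,3,2,1,2]]"

definition target_ok :: "nat list \<Rightarrow> nat \<times> nat \<times> bool \<Rightarrow> bool" where
  "target_ok cs t = (case t of (j, k, r) \<Rightarrow> j < length shapes \<and>
     spells ((if r then rev else id) (drop k cs @ take k cs)) (shapes ! j))"

definition runs :: "nat list \<Rightarrow> nat \<Rightarrow> pick list \<Rightarrow> pick list \<Rightarrow> nat list" where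
  "runs p c ok ks = filter (\<lambda>i. p ! i = c \<and> ks ! i \<in> set ok) [0..<length p]"

text \<open>\<open>lo\<close> and \<open>hi\<close> collect the sets of runs found to hold at most,
  respectively at least, the required amount. At \<open>Pick\<close>, the runs taken whole must lie
  within a set from \<open>lo\<close>, and the runs taken at least in part must contain a set from
  \<open>hi\<close>; the two added pairs express that an amount lies between 0 and the size of its
  class. Between these limits moving the cuts meets the amount exactly.\<close>

fun plan_ok :: "nat list \<Rightarrow> (nat \<times> nat list) list \<Rightarrow> (nat \<times> nat list) list \<Rightarrow> plan \<Rightarrow> bool" where
  "plan_ok p lo hi (Ask c I t u) = (plan_ok p ((c, I) # lo) hi t \<and> plan_ok p lo ((c, I) # hi) u)"
| "plan_ok p lo hi (Pick ks y n) =
    (length ks = length p \<and>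
     list_all (\<lambda>c.
       list_ex (\<lambda>(c', I). c' = c \<and> list_all (\<lambda>i. i \<in> set I) (runs p c [In] ks)) ((c, []) # lo) \<and>
       list_ex (\<lambda>(c', I). c' = c \<and> list_all (\<lambda>i. i \<in> set (runs p c [In, Pre, Suf] ks)) I)
         ((c, runs p c [Out, In, Pre, Suf] ks) # hi)) [0, 1, 2, 3] \<and>
     cyclic_changes (map snd (pieces p ks)) \<le> 8 \<and>
     target_ok (outcome (pieces p ks)) y \<and>
     target_ok (outcome (flip_marks (pieces p ks))) n)"

definition plans :: "plan list" where
  "plans = [
    (Ask 3 [6]
      (Ask 3 [4]
        (Ask 1 [3]
          (Ask 2 [2]
            (Ask 2 [2,7]
              (Pick [Pre,Pre,In,In,In,Suf,Pre,In] (0,0,False) (4,2,True))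
              (Pick [Pre,Pre,In,In,In,Out,Suf,Pre] (0,0,False) (4,2,True)))
            (Pick [Suf,Pre,Pre,In,In,Out,Pre,Out] (2,1,False) (0,0,False)))
          (Ask 2 [7]
            (Ask 2 [2,7]
              (Pick [Pre,Out,In,Suf,In,Suf,Pre,In] (0,0,False) (5,1,False))
              (Pick [Suf,Out,Suf,Suf,In,Out,Suf,In] (1,2,True) (1,0,False)))
            (Ask 2 [2]
              (Pick [Suf,Out,In,Suf,In,Out,Suf,Pre] (4,2,True) (1,0,False))
              (Pick [Suf,Out,Suf,Suf,In,Out,Pre,Out] (1,2,True) (1,0,False)))))
        (Ask 1 [3]
          (Ask 2 [7]
            (Ask 2 [5,7]
              (Pick [Pre,Pre,Suf,In,Pre,In,Out,In] (3,0,False) (6,2,True))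
              (Pick [Pre,Pre,Out,In,Pre,Suf,Out,In] (1,0,False) (6,2,True)))
            (Pick [Pre,Pre,Out,In,Pre,Out,In,Suf] (1,0,False) (6,2,True)))
          (Ask 2 [2,5]
            (Pick [Suf,Out,In,Pre,Suf,In,Out,Pre] (6,2,True) (3,0,False))
            (Ask 2 [2]
              (Pick [Suf,Out,In,Pre,Suf,Pre,In,Out] (6,2,True) (3,0,False))
              (Pick [Suf,Out,Suf,Suf,Pre,Out,In,Out] (1,2,True) (1,0,False))))))
      (Ask 3 [4]
        (Ask 1 [1]
          (Ask 2 [2,5]
            (Ask 2 [5,7]
              (Pick [Pre,In,Pre,Pre,Out,In,Pre,In] (1,0,False) (1,2,True))
              (Pick [Pre,In,Out,Pre,Out,In,Pre,Suf] (1,0,False) (4,2,True)))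
            (Ask 2 [5]
              (Pick [Pre,In,Pre,Pre,Out,In,Pre,Out] (1,0,False) (1,2,True))
              (Pick [Suf,In,Out,Pre,Out,Pre,Pre,Out] (5,1,False) (0,0,False))))
          (Ask 2 [2,5]
            (Pick [Suf,Suf,In,Out,Out,In,Pre,Pre] (6,2,True) (1,0,False))
            (Ask 2 [5]
              (Pick [Suf,Suf,Pre,Out,Out,In,Pre,Out] (6,2,True) (3,0,False))
              (Pick [Suf,Suf,Out,Out,Out,Pre,Pre,Out] (4,2,True) (0,0,False)))))
        (Ask 1 [1]
          (Ask 2 [2,5]
            (Ask 2 [5,7]
              (Pick [Pre,In,Pre,Pre,Out,In,Pre,In] (1,0,False) (1,2,True))
              (Pick [Pre,In,Out,Pre,Out,In,Pre,Suf] (1,0,False) (4,2,True)))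
            (Ask 2 [5]
              (Pick [Pre,In,Pre,Pre,Out,In,Pre,Out] (1,0,False) (1,2,True))
              (Pick [Suf,In,Out,Pre,Out,Pre,Pre,Out] (5,1,False) (0,0,False))))
          (Ask 2 [5,7]
            (Pick [Pre,Suf,Suf,Out,Out,In,Pre,In] (0,0,False) (2,1,False))
            (Ask 2 [5]
              (Pick [Suf,Suf,Out,Out,Out,In,Pre,Suf] (4,2,True) (0,0,False))
              (Pick [Suf,Suf,Out,Out,Out,Pre,Pre,Out] (4,2,True) (0,0,False))))))),
    (Ask 1 [4]
      (Ask 1 [1]
        (Ask 2 [2,7]
          (Ask 3 [3]
            (Ask 2 [5,7]
              (Pick [Pre,In,Pre,In,Pre,In,Pre,In] (1,0,False) (1,2,True))
              (Pick [Pre,In,Out,In,Pre,Pre,Suf,In] (1,0,False) (4,2,True)))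
            (Pick [Pre,In,In,Pre,Suf,Suf,Out,In] (3,0,False) (3,2,True)))
          (Ask 3 [6]
            (Ask 2 [2]
              (Pick [Pre,In,In,Pre,Suf,Out,In,Suf] (3,0,False) (3,2,True))
              (Pick [Suf,Pre,Pre,Suf,In,Out,In,Out] (2,1,False) (0,0,False)))
            (Ask 2 [2]
              (Pick [Pre,In,In,Out,Suf,Out,Suf,Pre] (0,0,False) (3,2,True))
              (Pick [Suf,In,Suf,Out,Suf,Out,Pre,Out] (5,2,True) (1,0,False)))))
        (Ask 2 [2,5]
          (Ask 3 [3]
            (Ask 2 [5,7]
              (Pick [Pre,Pre,Pre,In,In,In,Pre,In] (1,0,False) (4,2,True))
              (Pick [Pre,Pre,Out,In,In,In,Pre,Suf] (1,0,False) (6,2,True)))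
            (Pick [Suf,Suf,In,Pre,Out,In,Out,Pre] (6,2,True) (1,0,False)))
          (Ask 3 [6]
            (Ask 2 [2]
              (Pick [Suf,Suf,In,Pre,Out,Pre,In,Out] (6,2,True) (1,0,False))
              (Pick [Suf,Pre,Pre,Suf,In,Out,In,Out] (2,1,False) (0,0,False)))
            (Ask 2 [2]
              (Pick [Suf,Suf,In,Out,Out,Suf,Pre,Out] (6,2,True) (1,0,False))
              (Pick [Suf,Suf,Suf,Out,Out,Out,Pre,Out] (4,2,True) (1,0,False))))))
      (Ask 1 [1]
        (Ask 2 [5]
          (Ask 3 [3]
            (Ask 2 [5,7]
              (Pick [Pre,Out,Pre,In,Pre,In,Pre,In] (1,0,False) (5,2,True))
              (Pick [Pre,In,Out,In,Pre,In,Pre,Suf] (1,0,False) (4,2,True)))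
            (Ask 2 [5,7]
              (Pick [Pre,In,Suf,Pre,Suf,In,Out,In] (6,0,False) (3,2,True))
              (Pick [Suf,Out,Out,Suf,Pre,In,Out,Pre] (3,2,True) (3,0,False))))
          (Ask 3 [6]
            (Pick [Suf,Out,Out,Suf,Pre,Pre,In,Out] (3,2,True) (3,0,False))
            (Ask 2 [2]
              (Pick [Pre,In,In,Out,Suf,Suf,Pre,Out] (0,0,False) (3,2,True))
              (Pick [Suf,Out,Suf,Out,Suf,Out,Pre,Out] (1,2,True) (1,0,False)))))
        (Ask 2 [5]
          (Ask 3 [3]
            (Ask 2 [5,7]
              (Pick [Pre,Out,Pre,In,Pre,In,Pre,In] (1,0,False) (5,2,True))
              (Pick [Suf,Out,Out,In,Pre,In,Pre,Suf] (3,2,True) (0,0,False)))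
            (Ask 2 [5,7]
              (Pick [Pre,Suf,Suf,Pre,Out,In,Out,In] (0,0,False) (2,1,False))
              (Pick [Suf,Out,Out,Suf,Pre,In,Out,Pre] (3,2,True) (3,0,False))))
          (Ask 3 [6]
            (Pick [Suf,Out,Out,Suf,Pre,Pre,In,Out] (3,2,True) (3,0,False))
            (Ask 2 [2]
              (Pick [Suf,Out,In,Out,Suf,Suf,Pre,Out] (4,2,True) (1,0,False))
              (Pick [Suf,Out,Suf,Out,Suf,Out,Pre,Out] (1,2,True) (1,0,False))))))),
    (Ask 3 [5]
      (Ask 1 [4]
        (Ask 1 [4,6]
          (Pick [Pre,Pre,Pre,Pre,In,In,In] (2,0,False) (4,2,True))
          (Pick [Suf,Out,Pre,Suf,In,In,Suf] (1,2,True) (6,0,False)))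
        (Pick [Pre,Out,Pre,Suf,Pre,In,Out] (1,0,False) (6,1,False)))
      (Ask 1 [6]
        (Ask 1 [1,6]
          (Pick [Pre,In,Suf,Out,Suf,Pre,In] (5,1,True) (3,2,True))
          (Pick [Suf,Suf,Suf,Out,Out,Suf,In] (4,2,True) (1,0,False)))
        (Ask 1 [1]
          (Pick [Pre,In,Suf,Out,Out,Suf,Pre] (4,0,False) (1,2,True))
          (Pick [Pre,Suf,Suf,Out,Out,Pre,Out] (0,0,False) (2,1,False))))),
    (Ask 1 [5]
      (Ask 1 [1]
        (Ask 2 [2,7]
          (Ask 3 [6]
            (Ask 2 [2,4]
              (Pick [Pre,In,In,Pre,In,Suf,In,Suf] (3,0,False) (3,2,True))
              (Pick [Pre,In,In,Pre,Suf,Suf,In,Out] (3,0,False) (0,2,True)))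
            (Pick [Pre,In,In,Out,Pre,Pre,Suf,In] (1,0,False) (1,2,True)))
          (Ask 3 [3]
            (Ask 2 [7]
              (Pick [Pre,In,Pre,In,Out,Pre,Suf,In] (1,0,False) (1,2,True))
              (Pick [Pre,In,Out,In,Out,Suf,Pre,Suf] (3,0,False) (6,2,True)))
            (Ask 2 [7]
              (Pick [Pre,In,Suf,Pre,Out,Pre,Out,In] (4,0,False) (1,2,True))
              (Pick [Suf,In,Out,Pre,Out,Pre,Out,Pre] (5,1,False) (3,0,False)))))
        (Ask 2 [2]
          (Ask 3 [6]
            (Ask 2 [2,4]
              (Pick [Pre,Pre,In,Pre,In,In,In,Suf] (3,0,False) (4,2,True))
              (Pick [Pre,Pre,In,Pre,Suf,In,In,Out] (3,0,False) (4,2,True)))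
            (Ask 2 [2,4]
              (Pick [Suf,Suf,In,Out,In,Out,Suf,Pre] (6,2,True) (1,0,False))
              (Pick [Suf,Pre,In,Out,Pre,In,Pre,Out] (2,1,False) (0,0,False))))
          (Ask 3 [3]
            (Pick [Suf,Pre,Pre,In,Out,In,Pre,Out] (2,1,False) (0,0,False))
            (Ask 2 [7]
              (Pick [Pre,Pre,Suf,Pre,Out,In,Out,In] (4,0,False) (6,2,True))
              (Pick [Suf,Suf,Out,Pre,Out,Out,Out,Pre] (4,2,True) (3,0,False))))))
      (Ask 1 [1]
        (Ask 2 [4]
          (Ask 3 [6]
            (Ask 2 [2,4]
              (Pick [Pre,Out,In,Pre,In,Suf,In,Suf] (3,0,False) (5,1,False))
              (Pick [Pre,In,Pre,Suf,In,Suf,In,Out] (3,0,False) (0,2,True)))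
            (Ask 2 [2,4]
              (Pick [Suf,Out,In,Out,In,Pre,Suf,Pre] (6,2,True) (3,0,False))
              (Pick [Suf,Out,Suf,Out,In,Suf,Pre,Out] (1,2,True) (1,0,False))))
          (Ask 3 [3]
            (Pick [Suf,Out,Out,In,Suf,Suf,Pre,Out] (1,2,True) (1,0,False))
            (Ask 2 [7]
              (Pick [Pre,In,Out,Suf,Pre,Pre,Out,In] (4,0,False) (1,2,True))
              (Pick [Suf,Out,Out,Pre,Out,Pre,Out,Pre] (3,2,True) (3,0,False)))))
        (Ask 2 [4]
          (Ask 3 [6]
            (Ask 2 [2,4]
              (Pick [Pre,Out,In,Pre,In,Suf,In,Suf] (3,0,False) (5,1,False))
              (Pick [Suf,Out,Pre,Suf,In,Suf,In,Out] (1,2,True) (4,0,False)))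
            (Ask 2 [2,4]
              (Pick [Suf,Out,In,Out,In,Pre,Suf,Pre] (6,2,True) (3,0,False))
              (Pick [Suf,Out,Suf,Out,In,Suf,Pre,Out] (1,2,True) (1,0,False))))
          (Ask 3 [3]
            (Pick [Suf,Out,Out,In,Suf,Suf,Pre,Out] (1,2,True) (1,0,False))
            (Ask 2 [7]
              (Pick [Suf,Out,Out,Suf,Pre,Pre,Out,In] (0,2,True) (3,0,False))
              (Pick [Suf,Out,Out,Pre,Out,Pre,Out,Pre] (3,2,True) (3,0,False))))))),
    (Ask 2 [4,7]
      (Ask 3 [5]
        (Ask 1 [6]
          (Ask 2 [2,7]
            (Pick [Pre,Pre,In,Pre,Pre,In,In,In] (4,0,False) (4,2,True))
            (Pick [Pre,Pre,Suf,Pre,Out,In,In,In] (4,0,False) (6,2,True)))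
          (Ask 2 [2,7]
            (Pick [Pre,Out,In,Pre,Pre,In,Pre,In] (4,0,False) (5,2,True))
            (Pick [Suf,Out,Suf,Pre,Out,In,Pre,In] (0,2,True) (3,0,False))))
        (Ask 3 [3]
          (Ask 1 [1]
            (Pick [Pre,In,Suf,Out,In,Pre,Suf,In] (6,0,False) (3,2,True))
            (Pick [Pre,Suf,Suf,Out,In,Pre,Out,In] (0,0,False) (2,1,False)))
          (Ask 1 [1]
            (Pick [Pre,In,Suf,Out,In,Pre,Suf,In] (6,0,False) (3,2,True))
            (Pick [Pre,Suf,Suf,Out,In,Pre,Out,In] (0,0,False) (2,1,False)))))
      (Ask 3 [3]
        (Ask 2 [7]
          (Ask 1 [1]
            (Pick [Pre,In,Out,In,Suf,Pre,Suf,In] (6,0,False) (3,2,True))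
            (Pick [Pre,Suf,Out,In,Suf,Pre,Out,In] (0,0,False) (2,1,False)))
          (Ask 1 [6]
            (Pick [Pre,Pre,Out,In,Out,Suf,In,Suf] (1,0,False) (6,2,True))
            (Pick [Suf,Out,Out,In,Out,Suf,Pre,Pre] (3,2,True) (3,0,False))))
        (Ask 1 [1]
          (Ask 2 [4]
            (Pick [Pre,In,Out,Suf,In,Out,Suf,Suf] (3,0,False) (3,2,True))
            (Pick [Suf,In,Out,Pre,Suf,Out,Suf,Out] (5,2,True) (4,0,False)))
          (Ask 2 [4]
            (Pick [Suf,Suf,Out,Suf,In,Out,Out,Pre] (4,2,True) (1,0,False))
            (Pick [Suf,Suf,Out,Pre,Suf,Out,Out,Out] (4,2,True) (4,0,False)))))),
    (Ask 3 [2]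
      (Ask 1 [6]
        (Ask 1 [1,6]
          (Pick [Pre,In,In,Pre,Pre,Pre,In] (5,0,False) (4,2,True))
          (Pick [Pre,Pre,In,Out,Pre,Suf,In] (4,0,False) (4,2,True)))
        (Pick [Pre,Out,In,Out,Pre,Suf,Pre] (4,0,False) (6,1,False)))
      (Ask 1 [1]
        (Ask 1 [1,3]
          (Pick [Pre,In,Pre,In,Suf,Out,Suf] (2,1,True) (0,2,True))
          (Pick [Pre,In,Pre,Suf,Suf,Out,Out] (3,0,False) (3,2,True)))
        (Ask 1 [3]
          (Pick [Pre,Pre,Suf,In,Suf,Out,Out] (1,0,False) (4,2,True))
          (Pick [Pre,Out,Pre,Suf,Suf,Out,Out] (3,0,False) (5,1,False))))),
    (Ask 2 [3,7]
      (Ask 3 [2]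
        (Ask 1 [1]
          (Ask 2 [5,7]
            (Pick [Pre,In,In,Suf,Pre,In,Pre,In] (6,0,False) (1,2,True))
            (Pick [Pre,In,In,Out,Suf,Pre,Pre,In] (4,0,False) (1,2,True)))
          (Ask 2 [5,7]
            (Pick [Pre,Suf,In,Suf,Pre,In,Out,In] (0,0,False) (2,1,False))
            (Pick [Suf,Suf,In,Out,Suf,Pre,Out,In] (4,2,True) (3,0,False))))
        (Ask 3 [4]
          (Ask 1 [6]
            (Pick [Pre,Pre,Suf,In,Out,Pre,In,In] (4,0,False) (4,2,True))
            (Pick [Pre,Out,Suf,In,Out,Pre,Pre,In] (4,0,False) (5,2,True)))
          (Ask 1 [6]
            (Pick [Pre,Pre,Out,In,Pre,Pre,In,In] (4,0,False) (4,2,True))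
            (Pick [Pre,Out,Out,In,Pre,Pre,Pre,In] (4,0,False) (5,2,True)))))
      (Ask 3 [4]
        (Ask 2 [7]
          (Ask 1 [6]
            (Pick [Pre,Pre,Suf,Pre,In,Out,In,In] (4,0,False) (4,2,True))
            (Pick [Pre,Out,Suf,Pre,In,Out,Pre,In] (4,0,False) (5,2,True)))
          (Ask 1 [1]
            (Pick [Suf,In,Pre,Out,In,Out,Pre,Pre] (5,1,False) (3,0,False))
            (Pick [Suf,Suf,Pre,Out,In,Out,Out,Pre] (4,2,True) (3,0,False))))
        (Ask 1 [6]
          (Ask 2 [3]
            (Pick [Pre,Pre,Out,In,Pre,Out,In,Pre] (1,0,False) (4,2,True))
            (Pick [Suf,Pre,Out,Pre,Pre,Out,In,Out] (2,1,False) (0,0,False)))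
          (Ask 2 [3]
            (Pick [Suf,Out,Out,In,Pre,Out,Pre,Pre] (3,2,True) (3,0,False))
            (Pick [Suf,Out,Out,Pre,Pre,Out,Pre,Out] (3,2,True) (6,0,False))))))]"

text \<open>This finite check is the closure of the seven patterns: labels and boundaries are
  compared symbolically, so it holds for all run lengths and all amounts.\<close>

lemma plans_ok: "list_all2 (\<lambda>p t. plan_ok p [] [] t) shapes plans"
  by code_simp

section \<open>Soundness of the plans\<close>

definition amount :: "nat list \<Rightarrow> nat \<Rightarrow> pick list \<Rightarrow> pick list \<Rightarrow> nat list \<Rightarrow> nat" where
  "amount p c ok ks ls = (\<Sum>i<length p. if p ! i = c \<and> ks ! i \<in> set ok then ls ! i else 0)"

lemma amount_Nil [simp]: "amount [] c ok ks ls = 0"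
  by (simp add: amount_def)

lemma amount_Cons [simp]: "amount (x # p) c ok (k # ks) (l # ls) =
    (if x = c \<and> k \<in> set ok then l else 0) + amount p c ok ks ls"
  unfolding amount_def by (simp add: sum.lessThan_Suc_shift del: sum.lessThan_Suc cong: if_cong)

lemma amount_runs: "amount p c ok ks ls = (\<Sum>i\<in>set (runs p c ok ks). ls ! i)"
proof -
  have "set (runs p c ok ks) = {i \<in> {..<length p}. p ! i = c \<and> ks ! i \<in> set ok}"
    by (auto simp: runs_def)
  then show ?thesis unfolding amount_def by (simp only: sum.inter_filter finite_lessThan)
qed

text \<open>The actual lengths \<open>ls\<close> and amounts \<open>b\<close> decide every
  comparison and so single out one leaf. A failed comparison gives a strict inequality, of which
  \<open>hi\<close> keeps the weak form.\<close>

lemma plan_ok_sound: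
  assumes "plan_ok p lo hi t"
    and "\<forall>(c, I) \<in> set lo. (\<Sum>i\<in>set I. ls ! i) \<le> b c"
    and "\<forall>(c, I) \<in> set hi. b c \<le> (\<Sum>i\<in>set I. ls ! i)"
    and "\<forall>c<4. \<forall>ks. b c \<le> amount p c [Out, In, Pre, Suf] ks ls"
  obtains ks y n where "length ks = length p"
    "\<forall>c<4. amount p c [In] ks ls \<le> b c \<and> b c \<le> amount p c [In, Pre, Suf] ks ls"
    "cyclic_changes (map snd (pieces p ks)) \<le> 8"
    "target_ok (outcome (pieces p ks)) y" "target_ok (outcome (flip_marks (pieces p ks))) n"
  using assms
proof (induction t arbitrary: lo hi thesis)
  case (Ask c I t u)
  show ?case
  proof (cases "(\<Sum>i\<in>set I. ls ! i) \<le> b c")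
    case True
    show ?thesis by (rule Ask.IH(1)[where lo = "(c, I) # lo" and hi = hi]) (use Ask.prems True in auto)
  next
    case False
    show ?thesis by (rule Ask.IH(2)[where lo = lo and hi = "(c, I) # hi"]) (use Ask.prems False in auto)
  qed
next
  case (Pick ks y n)
  have bounds: "amount p c [In] ks ls \<le> b c \<and> b c \<le> amount p c [In, Pre, Suf] ks ls" if c: "c < 4" for c
  proof -
    have "c \<in> set [0, 1, 2, 3]" using c by auto
    then obtain I J where I: "(c, I) \<in> set ((c, []) # lo)" "set (runs p c [In] ks) \<subseteq> set I"
      and J: "(c, J) \<in> set ((c, runs p c [Out, In, Pre, Suf] ks) # hi)"
        "set J \<subseteq> set (runs p c [In, Pre, Suf] ks)"
      using Pick.prems(2) by (simp only: plan_ok.simps list_all_iff list_ex_iff) blast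
    have "amount p c [In] ks ls \<le> (\<Sum>i\<in>set I. ls ! i)"
      unfolding amount_runs by (rule sum_mono2) (use I in auto)
    moreover have "(\<Sum>i\<in>set I. ls ! i) \<le> b c" using I(1) Pick.prems(3) by auto
    moreover have "(\<Sum>i\<in>set J. ls ! i) \<le> amount p c [In, Pre, Suf] ks ls"
      unfolding amount_runs by (rule sum_mono2) (use J in auto)
    moreover have "b c \<le> (\<Sum>i\<in>set J. ls ! i)"
      using J(1) Pick.prems(4,5) c by (auto simp: amount_runs)
    ultimately show ?thesis by linarith
  qed
  show ?case by (rule Pick.prems(1)[of ks y n]) (use Pick.prems(2) bounds in auto)
qed

section \<open>Realising a question type on the circle\<close>

lemma cut_run:
  assumes "distinct r" "k = Out \<Longrightarrow> t = 0" "k = In \<Longrightarrow> t = length r" "t \<le> length r"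
  obtains bs T where "concat bs = r" "T \<subseteq> set r" "length (filter (\<lambda>e. e \<in> T) r) = t"
    "list_all2 (\<lambda>x f. \<forall>e\<in>set x. e \<in> T \<longleftrightarrow> f) bs (marks k)"
proof -
  have in_T: "length (filter (\<lambda>e. e \<in> T) r) = card T" if "T \<subseteq> set r" for T
  proof -
    have "set (filter (\<lambda>e. e \<in> T) r) = T" using that by auto
    then show ?thesis using distinct_card[of "filter (\<lambda>e. e \<in> T) r"] assms(1) by simp
  qed
  define s where "s = length r - t"
  have r: "r = take t r @ drop t r" "r = take s r @ drop s r" by simp_all
  have card: "card (set (take t r)) = t" "card (set (drop s r)) = t"
    using assms(1,4) by (simp_all add: distinct_card s_def)
  have disj: "set (take n r) \<inter> set (drop n r) = {}" for n
    using assms(1) by (simp add: set_take_disj_set_drop_if_distinct)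
  show thesis
  proof (cases k)
    case Out
    then show ?thesis using assms(2) by (intro that[of "[r]" "{}"]) auto
  next
    case In
    then show ?thesis using assms(3) in_T[of "set r"] distinct_card[OF assms(1)]
      by (intro that[of "[r]" "set r"]) auto
  next
    case Pre
    show ?thesis
      by (rule that[of "[take t r, drop t r]" "set (take t r)"])
        (use in_T[of "set (take t r)"] card disj[of t] in \<open>auto simp: Pre set_take_subset\<close>)
  next
    case Suf
    show ?thesis
      by (rule that[of "[take s r, drop s r]" "set (drop s r)"])
        (use in_T[of "set (drop s r)"] card disj[of s] in \<open>auto simp: Suf set_drop_subset\<close>)
  qed
qed

lemma cut_runs:
  assumes "list_all2 (\<lambda>r c. \<forall>e\<in>set r. \<sigma> e = c) rs p" "length ks = length p" "distinct (concat rs)"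
    and "\<forall>c<4. amount p c [In] ks (map length rs) \<le> b c \<and> b c \<le> amount p c [In, Pre, Suf] ks (map length rs)"
    and "\<forall>c\<in>set p. c < (4::nat)"
  obtains bs T where "concat bs = concat rs" "T \<subseteq> set (concat rs)"
    "\<forall>c<4. length (filter (\<lambda>e. \<sigma> e = c \<and> e \<in> T) (concat rs)) = b c"
    "list_all2 (\<lambda>x (c, f). \<forall>e\<in>set x. \<sigma> e = c \<and> (e \<in> T \<longleftrightarrow> f)) bs (pieces p ks)"
  using assms
proof (induction rs p arbitrary: ks b thesis rule: list_all2_induct)
  case Nil
  then show ?case by (intro Nil.prems(1)[of "[]" "{}"]) auto
next
  case (Cons r rs x p)
  obtain k ks' where ks: "ks = k # ks'" "length ks' = length p"
    using Cons.prems(2) by (cases ks) auto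
  have x: "x < 4" using Cons.prems(5) by simp
  let ?lo = "\<lambda>c. amount p c [In] ks' (map length rs)"
  let ?hi = "\<lambda>c. amount p c [In, Pre, Suf] ks' (map length rs)"
  \<comment> \<open>Greedy choice: a run that may be cut takes all it can of its class, reserving
    only what the later \<open>In\<close> runs must have. The remainder then fits between the limits
    of the later runs.\<close>
  define t where "t = (case k of Out \<Rightarrow> 0 | In \<Rightarrow> length r | _ \<Rightarrow> min (length r) (b x - ?lo x))"
  have bnd: "(if x = c \<and> k = In then length r else 0) + ?lo c \<le> b c \<and>
      b c \<le> (if x = c \<and> k \<noteq> Out then length r else 0) + ?hi c" if "c < 4" for c
    using Cons.prems(4) that by (cases k) (auto simp: ks)
  have lohi: "?lo c \<le> ?hi c" for c
    unfolding amount_def by (intro sum_mono) auto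
  have "t \<le> length r \<and> t \<le> b x \<and> ?lo x \<le> b x - t \<and> b x - t \<le> ?hi x"
    using bnd[OF x] lohi[of x] by (cases k) (auto simp: t_def min_def)
  then have t: "t \<le> length r" "t \<le> b x" "?lo x \<le> b x - t" "b x - t \<le> ?hi x" by blast+
  obtain bs1 T1 where 1: "concat bs1 = r" "T1 \<subseteq> set r" "length (filter (\<lambda>e. e \<in> T1) r) = t"
    "list_all2 (\<lambda>x f. \<forall>e\<in>set x. e \<in> T1 \<longleftrightarrow> f) bs1 (marks k)"
    by (rule cut_run[of r k t]) (use Cons.prems(3) t(1) in \<open>auto simp: t_def\<close>)
  let ?b = "b(x := b x - t)"
  obtain bs2 T2 where 2: "concat bs2 = concat rs" "T2 \<subseteq> set (concat rs)"
    "\<forall>c<4. length (filter (\<lambda>e. \<sigma> e = c \<and> e \<in> T2) (concat rs)) = ?b c"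
    "list_all2 (\<lambda>x (c, f). \<forall>e\<in>set x. \<sigma> e = c \<and> (e \<in> T2 \<longleftrightarrow> f)) bs2 (pieces p ks')"
  proof (rule Cons.IH[where ks = ks' and b = ?b])
    show "\<forall>c<4. ?lo c \<le> ?b c \<and> ?b c \<le> ?hi c"
    proof (intro allI impI)
      fix c :: nat
      assume "c < 4"
      then show "?lo c \<le> ?b c \<and> ?b c \<le> ?hi c" using bnd[of c] t by (cases "c = x") auto
    qed
  qed (use Cons.prems ks in auto)
  have disj: "set r \<inter> set (concat rs) = {}" using Cons.prems(3) by auto
  define T where "T = T1 \<union> T2"
  have T1: "e \<in> T \<longleftrightarrow> e \<in> T1" if "e \<in> set r" for e using that disj 2(2) by (auto simp: T_def)
  have T2: "e \<in> T \<longleftrightarrow> e \<in> T2" if "e \<in> set (concat rs)" for e using that disj 1(2) by (auto simp: T_def)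
  have fr: "filter (\<lambda>e. \<sigma> e = c \<and> e \<in> T) r = (if x = c then filter (\<lambda>e. e \<in> T1) r else [])" for c
    using Cons.hyps(1) T1 by (auto intro!: filter_cong simp: filter_empty_conv)
  have fs: "filter (\<lambda>e. \<sigma> e = c \<and> e \<in> T) (concat rs) = filter (\<lambda>e. \<sigma> e = c \<and> e \<in> T2) (concat rs)" for c
    using T2 by (intro filter_cong) auto
  show ?case
  proof (rule Cons.prems(1)[of "bs1 @ bs2" T])
    show "\<forall>c<4. length (filter (\<lambda>e. \<sigma> e = c \<and> e \<in> T) (concat (r # rs))) = b c"
      using 1(3) 2(3) t(2) by (auto simp: fr fs)
    have "list_all2 (\<lambda>x (c, f). \<forall>e\<in>set x. \<sigma> e = c \<and> (e \<in> T \<longleftrightarrow> f)) bs1 (map (Pair x) (marks k))"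
      unfolding list_all2_map2 prod.case
    proof (rule list.rel_mono_strong[OF 1(4)])
      fix z f
      assume "z \<in> set bs1" "\<forall>e\<in>set z. e \<in> T1 \<longleftrightarrow> f"
      moreover from this have "set z \<subseteq> set r" using 1(1) by auto
      ultimately show "\<forall>e\<in>set z. \<sigma> e = x \<and> (e \<in> T \<longleftrightarrow> f)" using Cons.hyps(1) T1 by auto
    qed
    moreover have "list_all2 (\<lambda>x (c, f). \<forall>e\<in>set x. \<sigma> e = c \<and> (e \<in> T \<longleftrightarrow> f)) bs2 (pieces p ks')"
    proof (rule list.rel_mono_strong[OF 2(4)])
      fix z y
      assume "z \<in> set bs2" "case y of (c, f) \<Rightarrow> \<forall>e\<in>set z. \<sigma> e = c \<and> (e \<in> T2 \<longleftrightarrow> f)"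
      moreover from this have "set z \<subseteq> set (concat rs)" unfolding 2(1)[symmetric] by auto
      ultimately show "case y of (c, f) \<Rightarrow> \<forall>e\<in>set z. \<sigma> e = c \<and> (e \<in> T \<longleftrightarrow> f)" using T2 by auto
    qed
    ultimately show "list_all2 (\<lambda>x (c, f). \<forall>e\<in>set x. \<sigma> e = c \<and> (e \<in> T \<longleftrightarrow> f)) (bs1 @ bs2) (pieces (x # p) ks)"
      by (simp add: ks list_all2_appendI)
  qed (use 1 2 in \<open>auto simp: T_def\<close>)
qed

text \<open>Along the recursion of \<open>spells\<close>, consecutive blocks with the same label are
  merged and skipped positions of the pattern become empty runs.\<close>

lemma spells_blocks:
  assumes "spells cs p" "list_all2 (\<lambda>r c. \<forall>e\<in>set r. \<sigma> e = c) bs cs"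
  obtains rs where "list_all2 (\<lambda>r c. \<forall>e\<in>set r. \<sigma> e = c) rs p" "concat rs = concat bs"
  using assms
proof (induction cs p arbitrary: bs thesis rule: spells.induct)
  case (1 ps)
  then show ?case by (intro "1.prems"(1)[of "map (\<lambda>_. []) ps"]) (auto simp: list_all2_conv_all_nth)
next
  case (2 c cs)
  then show ?case by simp
next
  case (3 c cs p ps)
  obtain x xs where bs: "bs = x # xs" "\<forall>e\<in>set x. \<sigma> e = c" "list_all2 (\<lambda>r c. \<forall>e\<in>set r. \<sigma> e = c) xs cs"
    using "3.prems"(3) by (auto simp: list_all2_Cons2)
  show ?case
  proof (cases "c = p")
    case True
    obtain rs where rs: "list_all2 (\<lambda>r c. \<forall>e\<in>set r. \<sigma> e = c) rs (p # ps)" "concat rs = concat xs"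
      by (rule "3.IH"(1)[OF True]) (use "3.prems"(2) bs True in auto)
    then obtain y ys where "rs = y # ys" by (cases rs) auto
    then show ?thesis using rs bs True by (intro "3.prems"(1)[of "(x @ y) # ys"]) auto
  next
    case False
    obtain rs where "list_all2 (\<lambda>r c. \<forall>e\<in>set r. \<sigma> e = c) rs ps" "concat rs = concat bs"
      by (rule "3.IH"(2)[OF False]) (use "3.prems" False in auto)
    then show ?thesis by (intro "3.prems"(1)[of "[] # rs"]) auto
  qed
qed

lemma live_blocks:
  assumes "list_all2 (\<lambda>r c. \<forall>e\<in>set r. \<sigma> e = c) bs cs"
  obtains bs' where "list_all2 (\<lambda>r c. \<forall>e\<in>set r. \<sigma> e = c) bs' (filter (\<lambda>c. c < (4::nat)) cs)"
    "concat bs' = filter (\<lambda>e. \<sigma> e < 4) (concat bs)"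
  using assms
proof (induction bs cs arbitrary: thesis rule: list_all2_induct)
  case (Cons r bs c cs)
  obtain bs' where bs': "list_all2 (\<lambda>r c. \<forall>e\<in>set r. \<sigma> e = c) bs' (filter (\<lambda>c. c < (4::nat)) cs)"
    "concat bs' = filter (\<lambda>e. \<sigma> e < 4) (concat bs)"
    by (rule Cons.IH)
  have "filter (\<lambda>e. \<sigma> e < 4) r = (if c < 4 then r else [])"
    using Cons.hyps(1) by (auto simp: filter_empty_conv filter_id_conv)
  then show ?case
    using bs' Cons.hyps(1) by (intro Cons.prems[of "(if c < 4 then [r] else []) @ bs'"]) auto
qed simp

text \<open>A cyclic word may be read from any point and in either direction; the split into
  \<open>ys\<close> and \<open>zs\<close> marks where the reading passes the ends of the
  line.\<close>

definition circular :: "nat list \<Rightarrow> bool" where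
  "circular xs \<longleftrightarrow> (\<exists>ys zs. xs = ys @ zs \<and> (sorted_wrt (<) (zs @ ys) \<or> sorted_wrt (<) (rev (zs @ ys))))"

lemma circular_swap: "circular (xs @ ys) \<Longrightarrow> circular (ys @ xs)"
proof -
  assume "circular (xs @ ys)"
  then obtain us vs where eq: "xs @ ys = us @ vs"
    and s: "sorted_wrt (<) (vs @ us) \<or> sorted_wrt (<) (rev (vs @ us))"
    unfolding circular_def by blast
  from eq consider ws where "xs = us @ ws" "ws @ ys = vs" | ws where "xs @ ws = us" "ys = ws @ vs"
    by (auto simp: append_eq_append_conv2)
  then show "circular (ys @ xs)"
  proof cases
    case 1
    then show ?thesis
      unfolding circular_def using s by (intro exI[of _ "ys @ us"] exI[of _ ws]) auto
  next
    case 2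
    then show ?thesis
      unfolding circular_def using s by (intro exI[of _ ws] exI[of _ "vs @ xs"]) auto
  qed
qed

lemma circular_rev: "circular xs \<Longrightarrow> circular (rev xs)"
proof -
  assume "circular xs"
  then obtain ys zs where "xs = ys @ zs" "sorted_wrt (<) (zs @ ys) \<or> sorted_wrt (<) (rev (zs @ ys))"
    unfolding circular_def by blast
  then show ?thesis
    unfolding circular_def by (intro exI[of _ "rev zs"] exI[of _ "rev ys"]) auto
qed

lemma circular_filter: "circular xs \<Longrightarrow> circular (filter P xs)"
proof -
  assume "circular xs"
  then obtain ys zs where xs: "xs = ys @ zs"
    and "sorted_wrt (<) (zs @ ys) \<or> sorted_wrt (<) (rev (zs @ ys))"
    unfolding circular_def by blast
  then have "sorted_wrt (<) (filter P (zs @ ys)) \<or> sorted_wrt (<) (rev (filter P (zs @ ys)))"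
    unfolding rev_filter by (blast intro: sorted_wrt_filter)
  then show ?thesis
    unfolding circular_def xs by (intro exI[of _ "filter P ys"] exI[of _ "filter P zs"]) simp
qed

lemma circular_distinct: "circular xs \<Longrightarrow> distinct xs"
  unfolding circular_def by (auto simp: strict_sorted_iff distinct_append)

text \<open>Rotation moves whole blocks, so their lengths do not matter; reflection must also
  reverse each block inside. The order of candidates changes, but the multiset, which determines the
  class sizes, does not.\<close>

lemma target_ok_blocks:
  assumes "target_ok cs t" "list_all2 (\<lambda>r c. \<forall>e\<in>set r. \<sigma> e = c) bs cs" "circular (concat bs)"
  obtains rs p where "p \<in> set shapes" "list_all2 (\<lambda>r c. \<forall>e\<in>set r. \<sigma> e = c) rs p"
    "circular (concat rs)" "mset (concat rs) = mset (concat bs)"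
proof -
  obtain j k r where t: "t = (j, k, r)" by (metis surj_pair)
  have j: "j < length shapes"
    and sp: "spells ((if r then rev else id) (drop k cs @ take k cs)) (shapes ! j)"
    using assms(1) by (simp_all add: target_ok_def t)
  define ds where "ds = drop k bs @ take k bs"
  have ds: "list_all2 (\<lambda>r c. \<forall>e\<in>set r. \<sigma> e = c) ds (drop k cs @ take k cs)"
    unfolding ds_def using assms(2) by (intro list_all2_appendI list_all2_dropI list_all2_takeI)
  have "concat bs = concat (take k bs) @ concat (drop k bs)"
    by (metis append_take_drop_id concat_append)
  then have circ: "circular (concat ds)" and ms: "mset (concat ds) = mset (concat bs)"
    using assms(3) circular_swap[of "concat (take k bs)" "concat (drop k bs)"] by (simp_all add: ds_def)
  have concat_rev: "concat (map rev (rev ds)) = rev (concat ds)" by (simp add: rev_concat rev_map)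
  define es where "es = (if r then map rev (rev ds) else ds)"
  have "list_all2 (\<lambda>r c. \<forall>e\<in>set r. \<sigma> e = c) (map rev (rev ds)) (rev (drop k cs @ take k cs))"
    using ds by (simp only: list_all2_map1 set_rev list_all2_rev)
  then have es: "list_all2 (\<lambda>r c. \<forall>e\<in>set r. \<sigma> e = c) es ((if r then rev else id) (drop k cs @ take k cs))"
    using ds by (simp add: es_def)
  obtain rs where rs: "list_all2 (\<lambda>r c. \<forall>e\<in>set r. \<sigma> e = c) rs (shapes ! j)" "concat rs = concat es"
    by (rule spells_blocks[OF sp es])
  show thesis
  proof (rule that[OF _ rs(1)])
    show "circular (concat rs)" using circ by (simp add: rs(2) es_def concat_rev circular_rev)
    show "mset (concat rs) = mset (concat bs)"
      using ms by (cases r) (simp_all only: rs(2) es_def concat_rev mset_rev if_True if_False)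
  qed (use j in auto)
qed

section \<open>Boundaries and intervals\<close>

lemma changes_append:
  "xs \<noteq> [] \<Longrightarrow> ys \<noteq> [] \<Longrightarrow> changes (xs @ ys) = changes xs + of_bool (last xs \<noteq> hd ys) + changes ys"
proof (induction xs rule: changes.induct)
  case ("2_2" v)
  then show ?case by (cases ys) auto
qed auto

lemma cyclic_changes_eq:
  "cyclic_changes xs = changes xs + of_bool (xs \<noteq> [] \<and> last xs \<noteq> hd xs)"
  by (cases xs) (auto simp: cyclic_changes_def)

lemma cyclic_changes_swap: "cyclic_changes (xs @ ys) = cyclic_changes (ys @ xs)"
  by (cases "xs = [] \<or> ys = []") (auto simp: cyclic_changes_eq changes_append)

lemma changes_rev: "changes (rev xs) = changes xs"
proof (induction xs rule: changes.induct)
  case (1 x y xs)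
  then show ?case using changes_append[of "rev xs @ [y]" "[x]"] by auto
qed auto

lemma cyclic_changes_rev: "cyclic_changes (rev xs) = cyclic_changes xs"
  by (auto simp: cyclic_changes_eq changes_rev last_rev hd_rev)

lemma changes_const: "\<forall>e\<in>set r. P e = f \<Longrightarrow> changes (f # map P r @ gs) = changes (f # gs)"
  by (induction r) auto

lemma changes_triangle: "changes (x # gs) \<le> of_bool (x \<noteq> y) + changes (y # gs)"
  by (cases gs) auto

text \<open>Empty blocks can only remove boundaries. The extra summand pays for a final part of
  \<open>fs\<close> that holds no candidates; without it the circle could not be closed
  afterwards.\<close>

lemma changes_blocks:
  assumes "list_all2 (\<lambda>r f. \<forall>e\<in>set r. P e = f) bs fs"
  shows "changes (x # map P (concat bs)) + of_bool (last (x # map P (concat bs)) \<noteq> last (x # fs))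
    \<le> changes (x # fs)"
  using assms
proof (induction bs fs arbitrary: x rule: list_all2_induct)
  case (Cons r bs f fs)
  define gs where "gs = map P (concat bs)"
  have IH: "changes (f # gs) + of_bool (last (f # gs) \<noteq> last (f # fs)) \<le> changes (f # fs)"
    unfolding gs_def by (rule Cons.IH)
  show ?case
  proof (cases r)
    case Nil
    then show ?thesis
      using IH changes_triangle[of x gs f] by (cases gs) (auto simp: gs_def[symmetric] split: if_splits)
  next
    case (Cons e r')
    have "changes (x # map P (r @ concat bs)) = of_bool (x \<noteq> f) + changes (f # gs)"
      using changes_const[of r' P f gs] Cons.hyps(1) by (simp add: Cons gs_def)
    moreover have "last (x # map P (r @ concat bs)) = last (f # gs)"
    proof (cases "gs = []")
      case True
      then have "map P (r @ concat bs) = map P r" by (simp add: gs_def)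
      moreover have "last (map P r) = f" using Cons.hyps(1) \<open>r = e # r'\<close> by (simp add: last_map)
      ultimately show ?thesis using True \<open>r = e # r'\<close> by (metis last.simps list.map_disc_iff append_is_Nil_conv list.distinct(1))
    qed (simp flip: gs_def)
    ultimately show ?thesis using IH by (simp add: gs_def)
  qed
qed simp

lemma cyclic_changes_blocks:
  assumes "list_all2 (\<lambda>r f. \<forall>e\<in>set r. P e = f) bs fs"
  shows "cyclic_changes (map P (concat bs)) \<le> cyclic_changes fs"
proof (cases "map P (concat bs) = []")
  case False
  define gs where "gs = map P (concat bs)"
  have fs: "fs \<noteq> []" using False assms by auto
  have gs: "gs \<noteq> []" using False by (simp add: gs_def)
  \<comment> \<open>Starting from \<open>last fs\<close> instead of \<open>last gs\<close> costs at
    most one boundary, exactly the summand carried by \<open>changes_blocks\<close>.\<close>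
  have "changes (last gs # gs) \<le> of_bool (last gs \<noteq> last fs) + changes (last fs # gs)"
    by (rule changes_triangle)
  also have "\<dots> \<le> changes (last fs # fs)"
    using changes_blocks[OF assms, of "last fs", folded gs_def] fs gs by simp
  finally show ?thesis using fs gs by (simp add: cyclic_changes_def gs_def)
qed (simp add: cyclic_changes_def)

fun true_runs :: "bool \<Rightarrow> bool list \<Rightarrow> nat" where
  "true_runs p [] = 0"
| "true_runs p (x # xs) = of_bool (x \<and> \<not> p) + true_runs x xs"

text \<open>Beginnings and ends of runs of \<open>True\<close> alternate, so their numbers differ
  only by the effect of the two extreme values.\<close>

lemma true_runs_changes:
  "2 * true_runs p xs + of_bool p = changes (p # xs) + of_bool (last (p # xs))"
proof (induction xs arbitrary: p)
  case (Cons x xs)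
  show ?case using Cons.IH[of x] by (cases x; cases p) auto
qed simp

text \<open>If the ends of the line differ, the cut is itself a boundary and at most 7 are left. If
  both are \<open>False\<close>, each run uses two boundaries. If both are \<open>True\<close>, the
  cut splits a run, and the complement has both ends \<open>False\<close>.\<close>

lemma true_runs_cyclic:
  assumes "cyclic_changes xs \<le> 8"
  shows "true_runs False xs \<le> 4 \<or> true_runs False (map Not xs) \<le> 4"
proof (cases xs)
  case (Cons x ys)
  have not: "changes (map Not zs) = changes zs" for zs
    by (induction zs rule: changes.induct) auto
  have "changes (x # ys) + of_bool (last (x # ys) \<noteq> x) \<le> 8"
    using assms by (simp add: Cons cyclic_changes_eq)
  moreover have "2 * true_runs False xs = of_bool x + changes (x # ys) + of_bool (last (x # ys))"
    using true_runs_changes[of False xs] by (auto simp: Cons)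
  moreover have "2 * true_runs False (map Not xs) = of_bool (\<not> x) + changes (x # ys) + of_bool (\<not> last (x # ys))"
    using true_runs_changes[of False "map Not xs"] not[of "x # ys"] by (auto simp: Cons last_map)
  ultimately show ?thesis by (cases x; cases "last (x # ys)"; simp)
qed simp

text \<open>Each interval spans a run from its first to its last candidate and may swallow other
  elements in between, so only the intersection with \<open>set es\<close> is controlled. The lower
  bound \<open>hd es\<close> and the form of the first interval serve the induction, which either
  prepends an interval or extends the first one downwards.\<close>

lemma true_runs_intervals:
  assumes "sorted_wrt (<) es" "set es \<subseteq> universe m"
  obtains Is where "length Is = true_runs False (map P es)" "\<forall>I\<in>set Is. is_interval m I"
    "\<forall>I\<in>set Is. \<forall>x\<in>I. hd es \<le> x" "\<Union> (set Is) \<inter> set es = {e \<in> set es. P e}"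
    "es \<noteq> [] \<Longrightarrow> P (hd es) \<Longrightarrow> \<exists>b Js. hd es \<le> b \<and> Is = {x \<in> universe m. hd es \<le> x \<and> x \<le> b} # Js"
  using assms
proof (induction es arbitrary: thesis)
  case Nil
  show ?case by (rule Nil.prems(1)[of "[]"]) auto
next
  case (Cons e es)
  have lt: "\<forall>y\<in>set es. e < y" and e: "e \<in> universe m" using Cons.prems by auto
  obtain Is where Is: "length Is = true_runs False (map P es)" "\<forall>I\<in>set Is. is_interval m I"
    "\<forall>I\<in>set Is. \<forall>x\<in>I. hd es \<le> x" "\<Union> (set Is) \<inter> set es = {e \<in> set es. P e}"
    "es \<noteq> [] \<Longrightarrow> P (hd es) \<Longrightarrow> \<exists>b Js. hd es \<le> b \<and> Is = {x \<in> universe m. hd es \<le> x \<and> x \<le> b} # Js"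
    by (rule Cons.IH) (use Cons.prems in auto)
  have above: "e < x" if "I \<in> set Is" "x \<in> I" for I x
  proof -
    have "es \<noteq> []" using that(1) Is(1) by auto
    then have "e < hd es" using lt by simp
    then show ?thesis using Is(3) that by fastforce
  qed
  have e_notin: "e \<notin> \<Union> (set Is)" using above by blast
  consider "\<not> P e" | "P e" "es = [] \<or> \<not> P (hd es)" | "P e" "es \<noteq> []" "P (hd es)" by blast
  then show ?case
  proof cases
    case 1
    show ?thesis
      by (rule Cons.prems(1)[of Is]) (use 1 Is e_notin above in \<open>auto simp: less_imp_le\<close>)
  next
    case 2
    have "true_runs True (map P es) = true_runs False (map P es)" using 2 by (cases es) auto
    moreover have "is_interval m {x \<in> universe m. e \<le> x \<and> x \<le> e}" unfolding is_interval_def by blast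
    ultimately show ?thesis
      using 2 Is e_notin above e lt
      by (intro Cons.prems(1)[of "{x \<in> universe m. e \<le> x \<and> x \<le> e} # Is"]) (auto simp: less_imp_le)
  next
    case 3
    obtain b Js where b: "hd es \<le> b" and Js: "Is = {x \<in> universe m. hd es \<le> x \<and> x \<le> b} # Js"
      using Is(5) 3 by blast
    have hd: "e < hd es" using lt 3 by simp
    have hd_le: "hd es \<le> y" if "y \<in> set es" for y
      using that Cons.prems(2) by (cases es) auto
    have len: "true_runs False (map P es) = Suc (true_runs True (map P es))" using 3 by (cases es) auto
    let ?I = "{x \<in> universe m. e \<le> x \<and> x \<le> b}"
    have "is_interval m ?I" unfolding is_interval_def by blast
    moreover have "\<Union> (set (?I # Js)) \<inter> set (e # es) = {y \<in> set (e # es). P y}"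
    proof -
      have "y \<in> ?I \<longleftrightarrow> y \<in> {x \<in> universe m. hd es \<le> x \<and> x \<le> b}" if "y \<in> set es" for y
        using hd_le[OF that] hd by auto
      then have "\<Union> (set (?I # Js)) \<inter> set es = \<Union> (set Is) \<inter> set es" unfolding Js by auto
      moreover have "e \<in> ?I" using e b hd by auto
      ultimately show ?thesis using Is(4) 3(1) by auto
    qed
    moreover have "\<forall>x\<in>I. e \<le> x" if "I \<in> set Js" for I
      using above[of I] that by (auto simp: Js less_imp_le)
    moreover have "\<exists>b' Ks. e \<le> b' \<and> ?I # Js = {x \<in> universe m. e \<le> x \<and> x \<le> b'} # Ks"
      using b hd by (intro exI[of _ b] exI[of _ Js]) auto
    ultimately show ?thesis
      using 3 Is(1,2) len by (intro Cons.prems(1)[of "?I # Js"]) (auto simp: Js)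
  qed
qed

lemma cyclic_question:
  assumes "circular es" "set es \<subseteq> universe m" "cyclic_changes (map (\<lambda>e. e \<in> T) es) \<le> 8" "T \<subseteq> set es"
  obtains Q where "Q \<subseteq> universe m" "four_interval_question m Q"
    "Q \<inter> set es = T \<or> Q \<inter> set es = set es - T"
proof -
  obtain ys zs where es: "es = ys @ zs" and s: "sorted_wrt (<) (zs @ ys) \<or> sorted_wrt (<) (rev (zs @ ys))"
    using assms(1) unfolding circular_def by blast
  define xs where "xs = (if sorted_wrt (<) (zs @ ys) then zs @ ys else rev (zs @ ys))"
  have sorted: "sorted_wrt (<) xs" and set: "set xs = set es" using s by (auto simp: xs_def es)
  have "cyclic_changes (map (\<lambda>e. e \<in> T) xs) \<le> 8"
    using assms(3) unfolding xs_def es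
    by (simp add: rev_map[symmetric] cyclic_changes_rev cyclic_changes_swap del: rev_append)
  from true_runs_cyclic[OF this] obtain P where P: "true_runs False (map P xs) \<le> 4"
    "P = (\<lambda>e. e \<in> T) \<or> P = (\<lambda>e. e \<notin> T)"
    by (auto simp: comp_def)
  obtain Is where Is: "length Is = true_runs False (map P xs)" "\<forall>I\<in>set Is. is_interval m I"
    "\<Union> (set Is) \<inter> set xs = {e \<in> set xs. P e}"
    by (rule true_runs_intervals[OF sorted, of m P]) (use assms(2) set in auto)
  show thesis
  proof (rule that[of "\<Union> (set Is)"])
    show "\<Union> (set Is) \<subseteq> universe m" using Is(2) by (auto simp: is_interval_def)
    show "four_interval_question m (\<Union> (set Is))"
      unfolding four_interval_question_def using Is(1,2) P(1) by (intro exI[of _ Is]) auto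
    show "\<Union> (set Is) \<inter> set es = T \<or> \<Union> (set Is) \<inter> set es = set es - T"
      using Is(3) P(2) assms(4) unfolding set by auto
  qed
qed

section \<open>Perfect strategies\<close>

definition winnable :: "nat \<Rightarrow> nat \<Rightarrow> state \<Rightarrow> bool" where
  "winnable m q \<sigma> \<longleftrightarrow> (\<exists>t. winning m q \<sigma> t \<and> (\<forall>Q \<in> questions t. four_interval_question m Q))"

lemma winnable_Suc:
  assumes "Q \<subseteq> universe m" "four_interval_question m Q"
    "winnable m q (state_yes \<sigma> Q)" "winnable m q (state_no \<sigma> Q)"
  shows "winnable m (Suc q) \<sigma>"
proof -
  obtain ty tn where "winning m q (state_yes \<sigma> Q) ty" "\<forall>Q \<in> questions ty. four_interval_question m Q"
    "winning m q (state_no \<sigma> Q) tn" "\<forall>Q \<in> questions tn. four_interval_question m Q"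
    using assms(3,4) unfolding winnable_def by blast
  then show ?thesis
    unfolding winnable_def using assms(1,2) by (intro exI[of _ "Node Q ty tn"]) auto
qed

lemma shapes_labels: "p \<in> set shapes \<Longrightarrow> c \<in> set p \<Longrightarrow> c < 4"
  by (auto simp: shapes_def)

lemma length_filter_blocks:
  assumes "list_all2 (\<lambda>r c. \<forall>e\<in>set r. \<sigma> e = c) rs p" "length ks = length p"
  shows "length (filter (\<lambda>e. \<sigma> e = c) (concat rs)) = amount p c [Out, In, Pre, Suf] ks (map length rs)"
  using assms
proof (induction rs p arbitrary: ks rule: list_all2_induct)
  case (Cons r rs x p)
  obtain k ks' where ks: "ks = k # ks'" "length ks' = length p"
    using Cons.prems by (cases ks) auto
  have "filter (\<lambda>e. \<sigma> e = c) r = (if x = c then r else [])"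
    using Cons.hyps(1) by (auto simp: filter_empty_conv filter_id_conv)
  then show ?case using Cons.IH[OF ks(2)] by (cases k) (auto simp: ks)
qed simp

definition shaped :: "nat \<Rightarrow> state \<Rightarrow> nat list \<Rightarrow> bool" where
  "shaped m \<sigma> es \<longleftrightarrow> circular es \<and> set es = {y \<in> universe m. \<sigma> y < 4} \<and>
     (\<exists>p \<in> set shapes. \<exists>rs. concat rs = es \<and> list_all2 (\<lambda>r c. \<forall>e\<in>set r. \<sigma> e = c) rs p)"

text \<open>An eliminated element stays at 4 whatever the answer, so \<open>Q\<close> has to agree
  with \<open>X\<close> or its complement on survivors only.\<close>

lemma state_answer:
  "(\<sigma> y < 4 \<Longrightarrow> y \<in> Q \<longleftrightarrow> y \<in> X) \<Longrightarrow> state_yes \<sigma> Q y = min (\<sigma> y + (if y \<in> X then 0 else 1)) 4"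
  "(\<sigma> y < 4 \<Longrightarrow> y \<in> Q \<longleftrightarrow> y \<notin> X) \<Longrightarrow> state_no \<sigma> Q y = min (\<sigma> y + (if y \<in> X then 0 else 1)) 4"
  by (cases "\<sigma> y < 4"; simp add: state_yes_def state_no_def)+

text \<open>\<open>X\<close> consists of the candidates with which the answer agrees, so one
  statement covers yes and no, and also the exchange of the two.\<close>

lemma shaped_answer:
  assumes "circular es" and alive: "set es = {y \<in> universe m. \<sigma> y < 4}"
    and bs: "concat bs = es" "list_all2 (\<lambda>x (c, f). \<forall>e\<in>set x. \<sigma> e = c \<and> (e \<in> X \<longleftrightarrow> f)) bs S"
    and "target_ok (outcome S) t"
    and \<tau>: "\<And>y. y \<in> universe m \<Longrightarrow> \<tau> y = min (\<sigma> y + (if y \<in> X then 0 else 1)) 4"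
  obtains es' where "shaped m \<tau> es'"
    "\<And>c. c < 4 \<Longrightarrow> length (filter (\<lambda>e. \<tau> e = c) es') =
      length (filter (\<lambda>e. \<sigma> e = c \<and> e \<in> X) es) + length (filter (\<lambda>e. \<sigma> e + 1 = c \<and> e \<notin> X) es)"
proof -
  have \<tau>': "\<tau> e = \<sigma> e + (if e \<in> X then 0 else 1)" if "e \<in> set es" for e
    using that \<tau> alive by auto
  have "list_all2 (\<lambda>r c. \<forall>e\<in>set r. \<tau> e = c) bs (map (\<lambda>(c, f). if f then c else c + 1) S)"
    unfolding list_all2_map2
  proof (rule list.rel_mono_strong[OF bs(2)])
    fix z y
    assume "z \<in> set bs" "case y of (c, f) \<Rightarrow> \<forall>e\<in>set z. \<sigma> e = c \<and> (e \<in> X \<longleftrightarrow> f)"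
    moreover from this have "set z \<subseteq> set es" using bs(1) by auto
    ultimately show "\<forall>e\<in>set z. \<tau> e = (case y of (c, f) \<Rightarrow> if f then c else c + 1)"
      using \<tau>' by (auto split: prod.splits)
  qed
  then obtain bs' where bs': "list_all2 (\<lambda>r c. \<forall>e\<in>set r. \<tau> e = c) bs' (outcome S)"
    "concat bs' = filter (\<lambda>e. \<tau> e < 4) es"
    unfolding outcome_def bs(1)[symmetric] by (rule live_blocks)
  obtain rs p where rs: "p \<in> set shapes" "list_all2 (\<lambda>r c. \<forall>e\<in>set r. \<tau> e = c) rs p"
    "circular (concat rs)" "mset (concat rs) = mset (concat bs')"
    by (rule target_ok_blocks[OF assms(5) bs'(1)]) (use assms(1) in \<open>simp_all add: bs'(2) circular_filter\<close>)
  have set: "set (concat rs) = {y \<in> universe m. \<tau> y < 4}"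
  proof -
    have "set (concat rs) = {e \<in> set es. \<tau> e < 4}"
      using mset_eq_setD[OF rs(4)] by (simp add: bs'(2))
    also have "\<dots> = {y \<in> universe m. \<tau> y < 4}"
      using \<tau> by (auto simp: alive)
    finally show ?thesis .
  qed
  show thesis
  proof (rule that[of "concat rs"])
    show "shaped m \<tau> (concat rs)" unfolding shaped_def using rs set by blast
    fix c :: nat
    assume c: "c < 4"
    have "length (filter (\<lambda>e. \<tau> e = c) (concat rs)) = size (filter_mset (\<lambda>e. \<tau> e = c) (mset (concat rs)))"
      by (metis mset_filter size_mset)
    also have "\<dots> = length (filter (\<lambda>e. \<tau> e = c) (filter (\<lambda>e. \<tau> e < 4) es))"
      unfolding rs(4) bs'(2) by (metis mset_filter size_mset)
    also have "\<dots> = length (filter (\<lambda>e. \<tau> e = c) es)"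
      using c by (simp add: conj_commute cong: conj_cong)
    also have "filter (\<lambda>e. \<tau> e = c) es = filter (\<lambda>e. \<sigma> e = c \<and> e \<in> X \<or> \<sigma> e + 1 = c \<and> e \<notin> X) es"
      using \<tau>' by (intro filter_cong) auto
    also have "length \<dots> = length (filter (\<lambda>e. \<sigma> e = c \<and> e \<in> X) es) + length (filter (\<lambda>e. \<sigma> e + 1 = c \<and> e \<notin> X) es)"
      by (induction es) auto
    finally show "length (filter (\<lambda>e. \<tau> e = c) (concat rs)) =
        length (filter (\<lambda>e. \<sigma> e = c \<and> e \<in> X) es) + length (filter (\<lambda>e. \<sigma> e + 1 = c \<and> e \<notin> X) es)" .
  qed
qed

lemma winnable_shaped:
  assumes "shaped m \<sigma> es"
    "wins q (length (filter (\<lambda>e. \<sigma> e = 0) es)) (length (filter (\<lambda>e. \<sigma> e = 1) es))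
      (length (filter (\<lambda>e. \<sigma> e = 2) es)) (length (filter (\<lambda>e. \<sigma> e = 3) es))"
  shows "winnable m q \<sigma>"
  using assms
proof (induction q arbitrary: \<sigma> es)
  case 0
  have alive: "set es = {y \<in> universe m. \<sigma> y < 4}" and "distinct es"
    using 0(1) circular_distinct by (auto simp: shaped_def)
  have "length es = length (filter (\<lambda>e. \<sigma> e = 0) es) + length (filter (\<lambda>e. \<sigma> e = 1) es) +
      length (filter (\<lambda>e. \<sigma> e = 2) es) + length (filter (\<lambda>e. \<sigma> e = 3) es)"
  proof -
    have "\<forall>e\<in>set es. \<sigma> e < 4" using alive by auto
    then show ?thesis
    proof (induction es)
      case (Cons e es)
      then have "\<sigma> e = 0 \<or> \<sigma> e = 1 \<or> \<sigma> e = 2 \<or> \<sigma> e = 3" by auto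
      then show ?case using Cons by auto
    qed simp
  qed
  then have "length es \<le> 1" using 0(2) by simp
  then have "final m \<sigma>"
    unfolding final_def alive[symmetric] using distinct_card[OF \<open>distinct es\<close>] by simp
  then show ?case unfolding winnable_def by (intro exI[of _ Leaf]) simp
next
  case (Suc q)
  let ?n = "\<lambda>c. length (filter (\<lambda>e. \<sigma> e = c) es)"
  have circ: "circular es" and alive: "set es = {y \<in> universe m. \<sigma> y < 4}"
    using Suc.prems(1) by (auto simp: shaped_def)
  obtain p rs where p: "p \<in> set shapes" and rs: "concat rs = es" "list_all2 (\<lambda>r c. \<forall>e\<in>set r. \<sigma> e = c) rs p"
    using Suc.prems(1) by (auto simp: shaped_def)
  obtain a0 a1 a2 a3 where le: "a0 \<le> ?n 0" "a1 \<le> ?n 1" "a2 \<le> ?n 2" "a3 \<le> ?n 3"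
    and wy: "wins q a0 (a1 + (?n 0 - a0)) (a2 + (?n 1 - a1)) (a3 + (?n 2 - a2))"
    and wn: "wins q (?n 0 - a0) (?n 1 - a1 + a0) (?n 2 - a2 + a1) (?n 3 - a3 + a2)"
    using Suc.prems(2) by (simp only: wins.simps) blast
  define b where "b c = [a0, a1, a2, a3] ! c" for c
  have b: "b 0 = a0" "b 1 = a1" "b 2 = a2" "b 3 = a3" by (simp_all add: b_def)
  have "b c \<le> ?n c" if "c < 4" for c
  proof -
    have "c = 0 \<or> c = 1 \<or> c = 2 \<or> c = 3" using that by auto
    then show ?thesis using le b by auto
  qed
  moreover have "?n c = amount p c [Out, In, Pre, Suf] ks (map length rs)" for c ks
  proof -
    have "?n c = amount p c [Out, In, Pre, Suf] (replicate (length p) In) (map length rs)"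
      using length_filter_blocks[OF rs(2), of "replicate (length p) In" c] rs(1) by simp
    also have "\<dots> = amount p c [Out, In, Pre, Suf] ks (map length rs)"
    proof -
      have "k \<in> set [Out, In, Pre, Suf]" for k by (cases k) auto
      then show ?thesis unfolding amount_def by (intro sum.cong) auto
    qed
    finally show ?thesis .
  qed
  ultimately have le_all: "\<forall>c<4. \<forall>ks. b c \<le> amount p c [Out, In, Pre, Suf] ks (map length rs)"
    by metis
  obtain t where "plan_ok p [] [] t"
    using plans_ok p by (metis in_set_conv_nth list_all2_conv_all_nth)
  then obtain ks y n where ks: "length ks = length p"
    "\<forall>c<4. amount p c [In] ks (map length rs) \<le> b c \<and> b c \<le> amount p c [In, Pre, Suf] ks (map length rs)"
    "cyclic_changes (map snd (pieces p ks)) \<le> 8"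
    "target_ok (outcome (pieces p ks)) y" "target_ok (outcome (flip_marks (pieces p ks))) n"
    by (rule plan_ok_sound) (use le_all in auto)
  obtain bs T where bs: "concat bs = concat rs" and T: "T \<subseteq> set (concat rs)"
    and cnt: "\<forall>c<4. length (filter (\<lambda>e. \<sigma> e = c \<and> e \<in> T) (concat rs)) = b c"
    and pc: "list_all2 (\<lambda>x (c, f). \<forall>e\<in>set x. \<sigma> e = c \<and> (e \<in> T \<longleftrightarrow> f)) bs (pieces p ks)"
    by (rule cut_runs[OF rs(2) ks(1) _ ks(2)])
      (use circ rs(1) p circular_distinct shapes_labels in auto)
  define T' where "T' = set es - T"
  have pc': "list_all2 (\<lambda>x (c, f). \<forall>e\<in>set x. \<sigma> e = c \<and> (e \<in> T' \<longleftrightarrow> f)) bs (flip_marks (pieces p ks))"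
    unfolding flip_marks_def list_all2_map2
  proof (rule list.rel_mono_strong[OF pc])
    fix z y
    assume "z \<in> set bs" "case y of (c, f) \<Rightarrow> \<forall>e\<in>set z. \<sigma> e = c \<and> (e \<in> T \<longleftrightarrow> f)"
    moreover from this have "set z \<subseteq> set es" unfolding rs(1)[symmetric] bs[symmetric] by auto
    ultimately show "case (case y of (c, f) \<Rightarrow> (c, \<not> f)) of (c, f) \<Rightarrow> \<forall>e\<in>set z. \<sigma> e = c \<and> (e \<in> T' \<longleftrightarrow> f)"
      by (auto simp: T'_def split: prod.splits)
  qed
  have inT: "length (filter (\<lambda>e. \<sigma> e = c \<and> e \<in> T) es) = b c" if "c < 4" for c
    using cnt that by (simp add: rs(1))
  have notT: "length (filter (\<lambda>e. \<sigma> e = c \<and> e \<notin> T) es) = ?n c - b c" if "c < 4" for c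
  proof -
    have "?n c = length (filter (\<lambda>e. \<sigma> e = c \<and> e \<in> T) es) + length (filter (\<lambda>e. \<sigma> e = c \<and> e \<notin> T) es)"
      by (induction es) auto
    then show ?thesis using inT[OF that] by simp
  qed
  have T': "filter (\<lambda>e. \<sigma> e = c \<and> e \<in> T') es = filter (\<lambda>e. \<sigma> e = c \<and> e \<notin> T) es"
    "filter (\<lambda>e. \<sigma> e = c \<and> e \<notin> T') es = filter (\<lambda>e. \<sigma> e = c \<and> e \<in> T) es" for c
    using T by (auto simp: T'_def rs(1) intro!: filter_cong)
  have yes: "winnable m q \<tau>"
    if \<tau>: "\<And>y. y \<in> universe m \<Longrightarrow> \<tau> y = min (\<sigma> y + (if y \<in> T then 0 else 1)) 4" for \<tau>
  proof -
    obtain es' where es': "shaped m \<tau> es'" "\<And>c. c < 4 \<Longrightarrow> length (filter (\<lambda>e. \<tau> e = c) es') =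
      length (filter (\<lambda>e. \<sigma> e = c \<and> e \<in> T) es) + length (filter (\<lambda>e. \<sigma> e + 1 = c \<and> e \<notin> T) es)"
      by (rule shaped_answer[OF circ alive _ pc ks(4) \<tau>]) (simp_all add: bs rs(1))
    have "Suc x = 2 \<longleftrightarrow> x = 1" "Suc x = 3 \<longleftrightarrow> x = 2" for x by auto
    then have "wins q (length (filter (\<lambda>e. \<tau> e = 0) es')) (length (filter (\<lambda>e. \<tau> e = 1) es'))
      (length (filter (\<lambda>e. \<tau> e = 2) es')) (length (filter (\<lambda>e. \<tau> e = 3) es'))"
      using wy inT notT b by (simp add: es'(2))
    then show ?thesis using Suc.IH es'(1) by blast
  qed
  have no: "winnable m q \<tau>"
    if \<tau>: "\<And>y. y \<in> universe m \<Longrightarrow> \<tau> y = min (\<sigma> y + (if y \<in> T' then 0 else 1)) 4" for \<tau>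
  proof -
    obtain es' where es': "shaped m \<tau> es'" "\<And>c. c < 4 \<Longrightarrow> length (filter (\<lambda>e. \<tau> e = c) es') =
      length (filter (\<lambda>e. \<sigma> e = c \<and> e \<in> T') es) + length (filter (\<lambda>e. \<sigma> e + 1 = c \<and> e \<notin> T') es)"
      by (rule shaped_answer[OF circ alive _ pc' ks(5) \<tau>]) (simp_all add: bs rs(1))
    have "Suc x = 2 \<longleftrightarrow> x = 1" "Suc x = 3 \<longleftrightarrow> x = 2" for x by auto
    then have "wins q (length (filter (\<lambda>e. \<tau> e = 0) es')) (length (filter (\<lambda>e. \<tau> e = 1) es'))
      (length (filter (\<lambda>e. \<tau> e = 2) es')) (length (filter (\<lambda>e. \<tau> e = 3) es'))"
      using wn inT notT b by (simp add: es'(2) T')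
    then show ?thesis using Suc.IH es'(1) by blast
  qed
  have "list_all2 (\<lambda>r f. \<forall>e\<in>set r. (e \<in> T) = f) bs (map snd (pieces p ks))"
    unfolding list_all2_map2 by (rule list.rel_mono_strong[OF pc]) auto
  from cyclic_changes_blocks[OF this] have ch: "cyclic_changes (map (\<lambda>e. e \<in> T) es) \<le> 8"
    using ks(3) by (simp add: bs rs(1))
  obtain Q where Q: "Q \<subseteq> universe m" "four_interval_question m Q"
    "Q \<inter> set es = T \<or> Q \<inter> set es = T'"
    unfolding T'_def by (rule cyclic_question[OF circ _ ch, of m]) (use alive T rs(1) in auto)
  from Q(3) show ?case
  proof
    assume "Q \<inter> set es = T"
    then have Q_iff: "y \<in> Q \<longleftrightarrow> y \<in> T" "y \<in> Q \<longleftrightarrow> y \<notin> T'" if "y \<in> universe m" "\<sigma> y < 4" for y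
      using that alive by (auto simp: T'_def)
    show ?case
    proof (rule winnable_Suc[OF Q(1,2)])
      show "winnable m q (state_yes \<sigma> Q)"
        by (intro yes state_answer Q_iff)
      show "winnable m q (state_no \<sigma> Q)"
        by (intro no state_answer Q_iff)
    qed
  next
    \<comment> \<open>The intervals describe the complement of \<open>T\<close> among the survivors,
      so here no has the effect planned for yes.\<close>
    assume "Q \<inter> set es = T'"
    then have Q_iff: "y \<in> Q \<longleftrightarrow> y \<in> T'" "y \<in> Q \<longleftrightarrow> y \<notin> T" if "y \<in> universe m" "\<sigma> y < 4" for y
      using that alive by (auto simp: T'_def)
    show ?case
    proof (rule winnable_Suc[OF Q(1,2)])
      show "winnable m q (state_yes \<sigma> Q)"
        by (intro no state_answer Q_iff)
      show "winnable m q (state_no \<sigma> Q)"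
        by (intro yes state_answer Q_iff)
    qed
  qed
qed

theorem theorem3:
  fixes m :: nat
  assumes "m \<notin> {2, 3, 5}"
  shows "\<exists>t. perfect_strategy m t \<and> (\<forall>Q \<in> questions t. four_interval_question m Q)"
proof -
  have "winnable m (N_min m) init_state"
  proof (rule winnable_shaped)
    have "sorted_wrt (<) ([] @ [0..<2 ^ m])" by simp
    then have "circular [0..<2 ^ m]" unfolding circular_def by (metis append_Nil2 append_Nil)
    \<comment> \<open>The initial word is a single run labelled 0, and every pattern begins with 0;
      the remaining runs are empty.\<close>
    moreover have "spells [0] (shapes ! 0)" by code_simp
    then obtain rs where "list_all2 (\<lambda>r c. \<forall>e\<in>set r. init_state e = c) rs (shapes ! 0)"
      "concat rs = concat [[0..<2 ^ m]]"
      by (rule spells_blocks[of _ _ init_state "[[0..<2 ^ m]]"]) (auto simp: init_state_def)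
    moreover have "shapes ! 0 \<in> set shapes" by (simp add: shapes_def)
    ultimately show "shaped m init_state [0..<2 ^ m]"
      unfolding shaped_def by (auto simp: universe_def init_state_def)
    show "wins (N_min m) (length (filter (\<lambda>e. init_state e = 0) [0..<2 ^ m]))
      (length (filter (\<lambda>e. init_state e = 1) [0..<2 ^ m]))
      (length (filter (\<lambda>e. init_state e = 2) [0..<2 ^ m]))
      (length (filter (\<lambda>e. init_state e = 3) [0..<2 ^ m]))"
      using wins_initial[OF assms] by (simp add: init_state_def)
  qed
  then show ?thesis by (simp add: winnable_def perfect_strategy_def)
qed

end
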